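(* Let $\Omega\subset\mathbb C^m$ be a domain. Let $K:\Omega\times\Omega\to\mathbb C$ be a (sesqui-analytic) non-negative definite kernel. Then the linear operator $\boldsymbol\partial:(\mathcal H,K)\to(\mathcal H,\mathcal G_{K^{-1}})$, where $\boldsymbol\partial f=(\partial_1f,\ldots,\partial_mf)^{\rm tr}$ for $f\in(\mathcal H,K)$, is bounded with $\|\boldsymbol\partial\|\le\|1\|_{(\mathcal H,K)}$. Moreover, if $K$ is normalized at the point $w_0\in\Omega$, that is, $K(\cdot,w_0)$ is the constant function $1$, then the linear operator $\boldsymbol\partial:(\mathcal H,K)\to(\mathcal H,\mathcal G_{K^{-1}})$ is contractive.
   Context: A function $K:\Omega\times\Omega\to\mathcal M_n(\mathbb C)$ is sesqui-analytic if $K(z,w)$ is holomorphic in $z$ and anti-holomorphic in $w$; it is a non-negative definite kernel if for every finite set $\{x_1,\dots,x_p\}\subset\Omega$ the $np\times np$ block matrix $(K(x_i,x_j))_{i,j=1}^p$ is non-negative definite. $(\mathcal H,K)$ denotes the unique Hilbert space of $\mathbb C^n$-valued functions on $\Omega$ with reproducing kernel $K$: $K(\cdot,x)\eta\in(\mathcal H,K)$ and $\langle f,K(\cdot,x)\eta\rangle=\langle f(x),\eta\rangle_{\mathbb C^n}$ for all $x\in\Omega$, $\eta\in\mathbb C^n$, $f\in(\mathcal H,K)$. $\|1\|_{(\mathcal H,K)}$ denotes the norm of the constant function $1$ in $(\mathcal H,K)$. For a scalar sesqui-analytic non-negative definite kernel $K$ on $\Omega\subset\mathbb C^m$, the Gaussian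 curvature is the $\mathcal M_m(\mathbb C)$-valued function $$\mathcal G_{K^{-1}}(z,w)=\Big(K(z,w)\,\partial_i\bar\partial_jK(z,w)-\partial_iK(z,w)\,\bar\partial_jK(z,w)\Big)_{i,j=1}^m,$$ where $\partial_i=\frac{\partial}{\partial z_i}$ and $\bar\partial_j=\frac{\partial}{\partial\bar w_j}$. It is known to be a non-negative definite kernel on $\Omega$, so the space $(\mathcal H,\mathcal G_{K^{-1}})$ of $\mathbb C^m$-valued functions is defined.
   Formalization: The first part assumes that the constant function 1 belongs to (H,K), so that its norm is defined; without this the claim fails, e.g. for K(z,w)=z·conj(w) on the unit disc, where the curvature is 0 but ∂z=1. *)

theory Defs
  imports "HOL-Analysis.Analysis"
begin

section \<open>Hilbert spaces of functions and reproducing kernels\<close>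

text \<open>
  A function on \<open>\<Omega>\<close> is represented by its extension by \<open>0\<close> to the whole type.
\<close>

definition zero_ext :: "'a set \<Rightarrow> ('a \<Rightarrow> 'v::zero) \<Rightarrow> 'a \<Rightarrow> 'v" where
  "zero_ext \<Omega> f = (\<lambda>z. if z \<in> \<Omega> then f z else 0)"

record ('a, 'v) function_space =
  elems :: "('a \<Rightarrow> 'v) set"
  form :: "('a \<Rightarrow> 'v) \<Rightarrow> ('a \<Rightarrow> 'v) \<Rightarrow> complex"

definition fnorm :: "('a, 'v) function_space \<Rightarrow> ('a \<Rightarrow> 'v) \<Rightarrow> real" where
  "fnorm S f = sqrt (Re (form S f f))"

text \<open>
  The parameter \<open>scl\<close> is the complex scalar multiplication of the value space, so that \<open>\<complex>\<close>-valued
  and \<open>\<complex>\<^sup>n\<close>-valued functions are treated alike.  Inner products are linear in the first argument.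
\<close>

definition hilbert_function_space ::
    "(complex \<Rightarrow> 'v \<Rightarrow> 'v) \<Rightarrow> 'a set \<Rightarrow> ('a, 'v::ab_group_add) function_space \<Rightarrow> bool" where
  "hilbert_function_space scl \<Omega> S \<longleftrightarrow>
     (\<forall>f\<in>elems S. \<forall>z. z \<notin> \<Omega> \<longrightarrow> f z = 0) \<and>
     (\<lambda>z. 0) \<in> elems S \<and>
     (\<forall>f\<in>elems S. \<forall>g\<in>elems S. (\<lambda>z. f z + g z) \<in> elems S) \<and>
     (\<forall>c. \<forall>f\<in>elems S. (\<lambda>z. scl c (f z)) \<in> elems S) \<and>
     (\<forall>f\<in>elems S. \<forall>g\<in>elems S. \<forall>h\<in>elems S.
        form S (\<lambda>z. f z + g z) h = form S f h + form S g h) \<and>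
     (\<forall>c. \<forall>f\<in>elems S. \<forall>h\<in>elems S. form S (\<lambda>z. scl c (f z)) h = c * form S f h) \<and>
     (\<forall>f\<in>elems S. \<forall>g\<in>elems S. form S g f = cnj (form S f g)) \<and>
     (\<forall>f\<in>elems S. form S f f \<in> \<real>\<^sub>\<ge>\<^sub>0) \<and>
     (\<forall>f\<in>elems S. form S f f = 0 \<longrightarrow> f = (\<lambda>z. 0)) \<and>
     (\<forall>F::nat \<Rightarrow> 'a \<Rightarrow> 'v.
        (\<forall>k. F k \<in> elems S) \<and>
        (\<forall>\<epsilon>>0. \<exists>N. \<forall>k\<ge>N. \<forall>l\<ge>N. fnorm S (\<lambda>z. F k z - F l z) < \<epsilon>) \<longrightarrow>
        (\<exists>f\<in>elems S. (\<lambda>k. fnorm S (\<lambda>z. F k z - f z)) \<longlonglongrightarrow> 0))"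

definition cvec_inner :: "complex ^ 'n \<Rightarrow> complex ^ 'n \<Rightarrow> complex" where
  "cvec_inner u v = (\<Sum>i\<in>UNIV. u $ i * cnj (v $ i))"

definition is_rkhs ::
    "'a set \<Rightarrow> ('a \<Rightarrow> 'a \<Rightarrow> complex) \<Rightarrow> ('a, complex) function_space \<Rightarrow> bool" where
  "is_rkhs \<Omega> K S \<longleftrightarrow>
     hilbert_function_space (*) \<Omega> S \<and>
     (\<forall>x\<in>\<Omega>. \<forall>\<eta>. zero_ext \<Omega> (\<lambda>z. K z x * \<eta>) \<in> elems S \<and>
        (\<forall>f\<in>elems S. form S f (zero_ext \<Omega> (\<lambda>z. K z x * \<eta>)) = f x * cnj \<eta>))"

definition is_vector_rkhs ::
    "'a set \<Rightarrow> ('a \<Rightarrow> 'a \<Rightarrow> complex ^ 'n ^ 'n) \<Rightarrow> ('a, complex ^ 'n) function_space \<Rightarrow> bool" where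
  "is_vector_rkhs \<Omega> K S \<longleftrightarrow>
     hilbert_function_space (*s) \<Omega> S \<and>
     (\<forall>x\<in>\<Omega>. \<forall>\<eta>. zero_ext \<Omega> (\<lambda>z. K z x *v \<eta>) \<in> elems S \<and>
        (\<forall>f\<in>elems S. form S f (zero_ext \<Omega> (\<lambda>z. K z x *v \<eta>)) = cvec_inner (f x) \<eta>))"

definition nonneg_definite_kernel :: "'a set \<Rightarrow> ('a \<Rightarrow> 'a \<Rightarrow> complex) \<Rightarrow> bool" where
  "nonneg_definite_kernel \<Omega> K \<longleftrightarrow>
     (\<forall>X c. finite X \<and> X \<subseteq> \<Omega> \<longrightarrow>
        (\<Sum>x\<in>X. \<Sum>y\<in>X. K x y * c y * cnj (c x)) \<in> \<real>\<^sub>\<ge>\<^sub>0)"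

section \<open>Sesqui-analytic functions\<close>

text \<open>Holomorphy in several variables: the Frechet derivative exists and is complex linear.\<close>

definition cvec_holomorphic_on :: "(complex ^ 'm \<Rightarrow> complex) \<Rightarrow> (complex ^ 'm) set \<Rightarrow> bool" where
  "cvec_holomorphic_on f \<Omega> \<longleftrightarrow>
     (\<forall>z\<in>\<Omega>. \<exists>D. (f has_derivative D) (at z within \<Omega>) \<and> (\<forall>c v. D (c *s v) = c * D v))"

definition sesqui_analytic ::
    "(complex ^ 'm) set \<Rightarrow> (complex ^ 'm \<Rightarrow> complex ^ 'm \<Rightarrow> complex) \<Rightarrow> bool" where
  "sesqui_analytic \<Omega> K \<longleftrightarrow>
     (\<forall>w\<in>\<Omega>. cvec_holomorphic_on (\<lambda>z. K z w) \<Omega>) \<and>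
     (\<forall>z\<in>\<Omega>. cvec_holomorphic_on (\<lambda>w. cnj (K z w)) \<Omega>)"

definition partial_deriv :: "'m \<Rightarrow> (complex ^ 'm \<Rightarrow> complex) \<Rightarrow> complex ^ 'm \<Rightarrow> complex" where
  "partial_deriv i f z = deriv (\<lambda>t. f (z + axis i t)) 0"

text \<open>
  For anti-holomorphic \<open>g\<close>, the Wirtinger derivative with respect to the conjugate of the \<open>j\<close>-th
  variable is the conjugate of the ordinary partial derivative of the conjugate of \<open>g\<close>.
\<close>

definition partial_deriv_bar :: "'m \<Rightarrow> (complex ^ 'm \<Rightarrow> complex) \<Rightarrow> complex ^ 'm \<Rightarrow> complex" where
  "partial_deriv_bar j g w = cnj (partial_deriv j (\<lambda>w'. cnj (g w')) w)"

definition gaussian_curvature ::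
    "(complex ^ 'm \<Rightarrow> complex ^ 'm \<Rightarrow> complex) \<Rightarrow>
     complex ^ 'm \<Rightarrow> complex ^ 'm \<Rightarrow> complex ^ 'm ^ 'm" where
  "gaussian_curvature K z w = (\<chi> i j.
     K z w * partial_deriv i (\<lambda>z'. partial_deriv_bar j (K z') w) z
     - partial_deriv i (\<lambda>z'. K z' w) z * partial_deriv_bar j (K z) w)"

definition gradient_op ::
    "(complex ^ 'm) set \<Rightarrow> (complex ^ 'm \<Rightarrow> complex) \<Rightarrow> complex ^ 'm \<Rightarrow> complex ^ 'm" where
  "gradient_op \<Omega> f = zero_ext \<Omega> (\<lambda>z. \<chi> i. partial_deriv i f z)"

section \<open>Bounded operators between function spaces\<close>

definition bounded_linear_op ::
    "(complex \<Rightarrow> 'u \<Rightarrow> 'u) \<Rightarrow> (complex \<Rightarrow> 'v \<Rightarrow> 'v) \<Rightarrow>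
     ('a, 'u::ab_group_add) function_space \<Rightarrow> ('b, 'v::ab_group_add) function_space \<Rightarrow>
     (('a \<Rightarrow> 'u) \<Rightarrow> ('b \<Rightarrow> 'v)) \<Rightarrow> bool" where
  "bounded_linear_op scl1 scl2 S1 S2 T \<longleftrightarrow>
     (\<forall>f\<in>elems S1. T f \<in> elems S2) \<and>
     (\<forall>f\<in>elems S1. \<forall>g\<in>elems S1. T (\<lambda>z. f z + g z) = (\<lambda>z. T f z + T g z)) \<and>
     (\<forall>c. \<forall>f\<in>elems S1. T (\<lambda>z. scl1 c (f z)) = (\<lambda>z. scl2 c (T f z))) \<and>
     (\<exists>C. \<forall>f\<in>elems S1. fnorm S2 (T f) \<le> C * fnorm S1 f)"

definition op_norm ::
    "('a, 'u) function_space \<Rightarrow> ('b, 'v) function_space \<Rightarrow> (('a \<Rightarrow> 'u) \<Rightarrow> ('b \<Rightarrow> 'v)) \<Rightarrow> real" where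
  "op_norm S1 S2 T = (SUP f\<in>{f \<in> elems S1. fnorm S1 f \<le> 1}. fnorm S2 (T f))"

end

theory Submission
  imports Defs "HOL-Complex_Analysis.Complex_Analysis"
begin

text \<open>
  Write \<open>k\<^sub>x\<close> for the kernel function at \<open>x\<close> and \<open>d\<^sub>x\<^sub>,\<^sub>i\<close> for the element of \<open>(H, K)\<close> that represents
  the functional \<open>f \<mapsto> \<partial>\<^sub>i f (x)\<close>.  The entries of the curvature are the \<open>2 \<times> 2\<close> Gram determinants
  \<open>\<langle>k\<^sub>y, k\<^sub>x\<rangle> \<langle>d\<^sub>y\<^sub>,\<^sub>j, d\<^sub>x\<^sub>,\<^sub>i\<rangle> - \<langle>k\<^sub>y, d\<^sub>x\<^sub>,\<^sub>i\<rangle> \<langle>d\<^sub>y\<^sub>,\<^sub>j, k\<^sub>x\<rangle>\<close>, that is, the inner products of the wedges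
  \<open>k\<^sub>y \<and> d\<^sub>y\<^sub>,\<^sub>j\<close> and \<open>k\<^sub>x \<and> d\<^sub>x\<^sub>,\<^sub>i\<close> (\<open>gaussian_curvature_eq\<close>).  So the norm in the curvature space of a
  finite combination of kernel functions is the norm of \<open>\<Sigma> c\<^sub>p k\<^sub>p \<and> d\<^sub>p\<close>, where \<open>p\<close> runs over pairs of a
  point and a coordinate.  The constant function \<open>1\<close> satisfies \<open>\<langle>k\<^sub>p, 1\<rangle> = 1\<close> and \<open>\<langle>d\<^sub>p, 1\<rangle> = 0\<close>, so the part
  of this wedge in the direction of \<open>1\<close> is \<open>1 \<and> \<Sigma> c\<^sub>p d\<^sub>p\<close> divided by \<open>\<parallel>1\<parallel>\<^sup>2\<close>, and discarding the orthogonal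
  rest gives \<open>\<parallel>\<Sigma> c\<^sub>p d\<^sub>p\<parallel> \<le> \<parallel>1\<parallel> \<parallel>\<Sigma> c\<^sub>p k\<^sub>p \<and> d\<^sub>p\<parallel>\<close> (\<open>norm_sum_le_wedge_gram\<close>).  Pairing with \<open>f\<close>, the
  functional that the gradient of \<open>f\<close> should induce on kernel functions is bounded by \<open>\<parallel>1\<parallel> \<parallel>f\<parallel>\<close>; by
  \<open>interpolation\<close>, a form of the Riesz representation theorem, it is then induced by an element of the
  curvature space of norm at most \<open>\<parallel>1\<parallel> \<parallel>f\<parallel>\<close>, and this element is the gradient of \<open>f\<close>.  If \<open>K(\<cdot>, w\<^sub>0) = 1\<close>, then
  \<open>\<parallel>1\<parallel>\<^sup>2 = \<langle>1, k\<^sub>w\<rangle> = 1\<close> for \<open>w = w\<^sub>0\<close>.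

  The representing elements \<open>d\<^sub>x\<^sub>,\<^sub>i\<close> exist once \<open>\<parallel>k\<^sub>x\<parallel>\<^sup>2 = K(x, x)\<close> is bounded near each point on the complex
  lines parallel to the axes: then every \<open>f\<close> is, on such a line, a bounded pointwise limit of
  holomorphic functions, and Cauchy's estimate bounds its derivative by a multiple of \<open>\<parallel>f\<parallel>\<close>.  Since the
  kernel is only assumed to be holomorphic in \<open>z\<close> and antiholomorphic in \<open>w\<close> separately, this boundedness
  is Hartogs' theorem on separate holomorphy (\<open>separately_holomorphic_locally_bounded\<close>).
\<close>

section \<open>A subharmonic majorant of log max(|f|, 1) on the disc\<close>

text \<open>
  On the unit circle \<open>cnj x = 1 / x\<close>, and \<open>2 Re u Re v = Re (u v) + Re (cnj u v)\<close>; applied to monomials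
  of degrees \<open>m \<le> n\<close> this yields monomials of degrees \<open>m + n\<close> and \<open>n - m\<close>.
\<close>

lemma Re_poly_mult_on_circle:
  fixes p q :: "complex poly"
  shows "\<exists>r. \<forall>x\<in>sphere 0 1. Re (poly p x) * Re (poly q x) = Re (poly r x)"
proof -
  have mono: "\<exists>r. \<forall>x\<in>sphere 0 1. Re (a * x ^ m) * Re (b * x ^ n) = Re (poly r x)"
    if "m \<le> n" for a b :: complex and m n
  proof (intro exI ballI)
    fix x :: complex assume "x \<in> sphere 0 1"
    then have x: "x * cnj x = 1"
      by (simp add: complex_norm_square[symmetric])
    have "cnj (x ^ m) * x ^ n = (x * cnj x) ^ m * x ^ (n - m)"
      using that by (simp add: power_mult_distrib mult_ac flip: power_add)
    then have e: "cnj (a * x ^ m) * (b * x ^ n) = cnj a * b * x ^ (n - m)"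
      by (simp add: x mult_ac)
    have "Re u * Re v = Re (u * v / 2) + Re (cnj u * v / 2)" for u v :: complex
      by (simp add: field_simps)
    then have "Re (a * x ^ m) * Re (b * x ^ n)
        = Re (a * x ^ m * (b * x ^ n) / 2) + Re (cnj (a * x ^ m) * (b * x ^ n) / 2)"
      by blast
    also have "\<dots> = Re (poly (monom (a * b / 2) (m + n) + monom (cnj a * b / 2) (n - m)) x)"
      unfolding e by (simp add: poly_monom power_add mult_ac del: Re_divide_numeral)
    finally show "Re (a * x ^ m) * Re (b * x ^ n)
        = Re (poly (monom (a * b / 2) (m + n) + monom (cnj a * b / 2) (n - m)) x)" .
  qed
  have ex: "\<exists>r. \<forall>x\<in>sphere 0 1. Re (a * x ^ m) * Re (b * x ^ n) = Re (poly r x)"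
    for a b :: complex and m n
    using mono[of m n a b] mono[of n m b a] by (metis linear mult.commute)
  define r where "r a b m n = (SOME r. \<forall>x\<in>sphere 0 1.
      Re (a * x ^ m) * Re (b * x ^ n) = Re (poly r x))" for a b :: complex and m n
  have r: "Re (a * x ^ m) * Re (b * x ^ n) = Re (poly (r a b m n) x)"
    if "x \<in> sphere 0 1" for a b x :: complex and m n
    using someI_ex[OF ex[of a m b n]] that unfolding r_def by blast
  show ?thesis
  proof (intro exI ballI)
    fix x :: complex assume x: "x \<in> sphere 0 1"
    show "Re (poly p x) * Re (poly q x) =
        Re (poly (\<Sum>i\<le>degree p. \<Sum>j\<le>degree q. r (coeff p i) (coeff q j) i j) x)"
      unfolding poly_altdef[of p] poly_altdef[of q] poly_sum Re_sum sum_product r[OF x] ..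
  qed
qed

text \<open>
  This makes the Stone-Weierstrass theorem a theorem about uniform approximation on the circle by
  real parts of holomorphic polynomials, which solves the Dirichlet problem up to a small error.
\<close>

lemma real_polynomial_on_circle:
  fixes g :: "complex \<Rightarrow> real"
  assumes "real_polynomial_function g"
  shows "\<exists>p::complex poly. \<forall>x\<in>sphere 0 1. g x = Re (poly p x)"
  using assms
proof (induction rule: real_polynomial_function.induct)
  case (linear g)
  have lin: "g x = Re x * g 1 + Im x * g \<i>" for x
  proof -
    have "x = Re x *\<^sub>R 1 + Im x *\<^sub>R \<i>"
      by (simp add: complex_eq_iff)
    then have "g x = g (Re x *\<^sub>R 1 + Im x *\<^sub>R \<i>)"
      by simp
    also have "\<dots> = Re x * g 1 + Im x * g \<i>"
      using linear by (simp add: linear_simps)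
    finally show ?thesis .
  qed
  have "g x = Re (poly [:0, Complex (g 1) (- g \<i>):] x)" for x
    using lin[of x] by simp
  then show ?case by (intro exI ballI)
next
  case (const c)
  have "c = Re (poly [:of_real c:] x)" for x :: complex
    by simp
  then show ?case by (intro exI ballI)
next
  case (add f g)
  then obtain p q :: "complex poly" where
    "\<forall>x\<in>sphere 0 1. f x = Re (poly p x)" "\<forall>x\<in>sphere 0 1. g x = Re (poly q x)"
    by blast
  then have "\<forall>x\<in>sphere 0 1. f x + g x = Re (poly (p + q) x)"
    by simp
  then show ?case by (intro exI)
next
  case (mult f g)
  then obtain p q :: "complex poly" where
    "\<forall>x\<in>sphere 0 1. f x = Re (poly p x)" "\<forall>x\<in>sphere 0 1. g x = Re (poly q x)"
    by blast
  moreover obtain r where "\<forall>x\<in>sphere 0 1. Re (poly p x) * Re (poly q x) = Re (poly r x)"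
    using Re_poly_mult_on_circle[of p q] by blast
  ultimately have "\<forall>x\<in>sphere 0 1. f x * g x = Re (poly r x)"
    by metis
  then show ?case by (intro exI)
qed

lemma has_integral_mean_value_circle:
  assumes "f holomorphic_on cball 0 1"
  shows "((\<lambda>t. f (cis (2 * pi * t))) has_integral f 0) {0..1}"
proof -
  have "((\<lambda>u. f u / (u - 0)) has_contour_integral (2 * of_real pi * \<i> * f 0)) (circlepath 0 1)"
    using Cauchy_integral_circlepath_simple[OF assms, of 0] by simp
  then have "((\<lambda>t. f (exp (2 * of_real pi * \<i> * of_real t)) * (2 * of_real pi * \<i>)) 
     has_integral (2 * of_real pi * \<i> * f 0)) {0..1}"
    unfolding has_contour_integral_def
    by (rule has_integral_eq[rotated])
       (simp add: vector_derivative_circlepath01, simp add: circlepath mult_ac)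
  then have "((\<lambda>t. f (exp (2 * of_real pi * \<i> * of_real t)) * (2 * of_real pi * \<i>) * (1 / (2 * of_real pi * \<i>))) 
     has_integral (2 * of_real pi * \<i> * f 0) * (1 / (2 * of_real pi * \<i>))) {0..1}"
    by (rule has_integral_mult_left)
  then show ?thesis
    by (simp add: cis_conv_exp mult_ac)
qed

lemma norm_le_of_norm_diff_le_half:
  fixes q :: complex and a :: real
  assumes "0 \<le> a" "norm (q - a) \<le> norm (q + a) / 2"
  shows "norm q \<le> 3 * a"
proof -
  have "norm q - a \<le> norm (q - a)"
    using norm_triangle_ineq2[of q a] assms by simp
  moreover have "norm (q + a) \<le> norm q + a"
    using norm_triangle_ineq[of q a] assms by simp
  ultimately show ?thesis using assms by simp
qed

text \<open>
  Harnack's inequality for the radius \<open>1/2\<close>, where the constant \<open>(1 + r) / (1 - r)\<close> is \<open>3\<close>.  With \<open>a = Re (p 0)\<close>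
  and \<open>q\<close> the function \<open>p\<close> shifted to have \<open>q 0 = a\<close>, the Cayley transform \<open>(q - a) / (q + a)\<close> maps the disc to itself and
  fixes \<open>0\<close>, so Schwarz's lemma applies.
\<close>

lemma Harnack_half_disc:
  assumes hol: "p holomorphic_on ball 0 1"
    and pos: "\<And>z. norm z < 1 \<Longrightarrow> 0 < Re (p z)"
    and w: "norm w \<le> 1/2"
  shows "Re (p w) \<le> 3 * Re (p 0)"
proof -
  define a where "a = Re (p 0)"
  define q where "q z = p z - \<i> * Im (p 0)" for z
  have a: "a > 0" using pos[of 0] by (simp add: a_def)
  have q0: "q 0 = a" by (simp add: q_def a_def complex_eq_iff)
  have Req: "Re (q z) = Re (p z)" for z by (simp add: q_def)
  have nz: "q z + a \<noteq> 0" if "norm z < 1" for z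
    using pos[OF that] a Req[of z] by (metis Re_complex_of_real add_pos_pos less_irrefl plus_complex.sel(1) zero_complex.sel(1))
  have lt: "norm (q z - a) < norm (q z + a)" if "norm z < 1" for z
  proof -
    have "(norm (q z - a))\<^sup>2 = (norm (q z + a))\<^sup>2 - 4 * a * Re (q z)"
      unfolding cmod_power2 by (simp add: power2_eq_square algebra_simps)
    also have "\<dots> < (norm (q z + a))\<^sup>2"
      using pos[OF that] a Req[of z] by simp
    finally show ?thesis
      by (rule power_less_imp_less_base) simp
  qed
  have "norm ((q w - a) / (q w + a)) \<le> norm w"
  proof (rule Schwarz_Lemma(1)[where f = "\<lambda>z. (q z - a) / (q z + a)"])
    show "(\<lambda>z. (q z - a) / (q z + a)) holomorphic_on ball 0 1"
      unfolding q_def using nz by (intro holomorphic_intros hol) (auto simp: q_def)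
    show "norm ((q z - a) / (q z + a)) < 1" if "norm z < 1" for z
      using lt[OF that] nz[OF that] by (simp add: norm_divide)
  qed (use q0 w in auto)
  then have "norm (q w - a) \<le> norm w * norm (q w + a)"
    using nz[of w] w by (simp add: norm_divide divide_le_eq)
  also have "\<dots> \<le> norm (q w + a) / 2"
    using mult_right_mono[OF w norm_ge_zero[of "q w + a"]] by simp
  finally have "norm (q w - a) \<le> norm (q w + a) / 2" .
  then have "norm (q w) \<le> 3 * a"
    using a by (intro norm_le_of_norm_diff_le_half) auto
  then show ?thesis
    using complex_Re_le_cmod[of "q w"] Req[of w] by (simp add: a_def)
qed

text \<open>
  The function \<open>log max(|f|, 1)\<close> is subharmonic and nonnegative, so on the half disc it is at most three
  times its mean over the unit circle.  Its boundary values are continuous, so they can be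
  approximated from above by the real part of a polynomial \<open>p\<close>; the maximum principle for \<open>f exp(-p)\<close>
  transfers the comparison to the disc, and Harnack's inequality compares \<open>Re p\<close> with its mean.
  Truncating \<open>|f|\<close> below at \<open>1\<close> is harmless for the application and avoids the zeros of \<open>f\<close>.
\<close>

lemma norm_le_exp_mean_log:
  assumes hol: "f holomorphic_on S" "open S" "cball 0 1 \<subseteq> S"
    and w: "norm w \<le> 1/2"
  shows "norm (f w) \<le> exp (3 * integral {0..1} (\<lambda>t. ln (max (norm (f (cis (2 * pi * t)))) 1)))"
proof -
  define \<phi> where "\<phi> x = ln (max (norm (f x)) 1)" for x
  define I where "I = integral {0..1} (\<lambda>t. \<phi> (cis (2 * pi * t)))"
  have contf: "continuous_on (cball 0 1) f"
    using hol holomorphic_on_imp_continuous_on holomorphic_on_subset by blast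
  have cont\<phi>: "continuous_on (cball 0 1) \<phi>"
    unfolding \<phi>_def by (intro continuous_intros contf) auto
  have cis: "continuous_on {0..1} (\<lambda>t. cis (2 * pi * t))"
    unfolding cis_conv_exp by (intro continuous_intros)
  have int\<phi>: "(\<lambda>t. \<phi> (cis (2 * pi * t))) integrable_on {0..1}"
    by (rule integrable_continuous_interval)
       (rule continuous_on_compose2[OF cont\<phi> cis], auto)
  have main: "norm (f w) \<le> exp (3 * (I + 2 * \<eta>))" if \<eta>: "\<eta> > 0" for \<eta>
  proof -
    have cont: "continuous_on (sphere 0 1) (\<lambda>x. \<phi> x + \<eta>)"
      by (intro continuous_intros continuous_on_subset[OF cont\<phi>]) auto
    obtain g where g: "real_polynomial_function g"
        "\<And>x. x \<in> sphere 0 1 \<Longrightarrow> \<bar>\<phi> x + \<eta> - g x\<bar> < \<eta>"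
      by (rule Stone_Weierstrass_real_polynomial_function[OF compact_sphere cont \<eta>]) (rule that)
    obtain p :: "complex poly" where p: "\<And>x. x \<in> sphere 0 1 \<Longrightarrow> g x = Re (poly p x)"
      using real_polynomial_on_circle[OF g(1)] by blast
    have bd: "\<phi> x < Re (poly p x)" "Re (poly p x) < \<phi> x + 2 * \<eta>" if "x \<in> sphere 0 1" for x
      using g(2)[OF that] p[OF that] by auto
    have \<phi>0: "0 \<le> \<phi> x" for x by (simp add: \<phi>_def)
    have hp: "(\<lambda>x. poly p x) holomorphic_on A" for A
      by (intro holomorphic_intros)
    have mm: "norm (h z) \<le> 1" if "h holomorphic_on S" "\<And>x. x \<in> sphere 0 1 \<Longrightarrow> norm (h x) \<le> 1"
      "norm z \<le> 1" for h z
    proof (rule maximum_modulus_frontier[where S = "cball 0 1" and f = h])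
      show "h holomorphic_on interior (cball 0 1)"
        using that(1) order_trans[OF interior_subset hol(3)] by (rule holomorphic_on_subset)
      show "continuous_on (closure (cball 0 1)) h"
        using holomorphic_on_imp_continuous_on[OF holomorphic_on_subset[OF that(1) hol(3)]] by simp
    qed (use that in auto)
    have quot: "norm (f z * exp (- poly p z)) = norm (f z) / exp (Re (poly p z))" for z
      by (simp only: norm_mult norm_exp_eq_Re exp_minus norm_inverse divide_inverse)
    have exp_le: "norm (f z) \<le> exp (Re (poly p z))" if "norm z \<le> 1" for z
    proof -
      have "norm (f z * exp (- poly p z)) \<le> 1"
      proof (rule mm[OF _ _ that, where h = "\<lambda>z. f z * exp (- poly p z)"])
        show "(\<lambda>z. f z * exp (- poly p z)) holomorphic_on S"
          by (intro holomorphic_intros hol hp)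
        fix x :: complex assume x: "x \<in> sphere 0 1"
        have "norm (f x) \<le> max (norm (f x)) 1" by simp
        also have "\<dots> = exp (\<phi> x)" by (simp add: \<phi>_def)
        also have "\<dots> \<le> exp (Re (poly p x))" using bd(1)[OF x] by simp
        finally show "norm (f x * exp (- poly p x)) \<le> 1"
          unfolding quot by simp
      qed
      then show ?thesis unfolding quot by simp
    qed
    have nonneg: "0 \<le> Re (poly p z)" if "norm z \<le> 1" for z
    proof -
      have "norm (exp (- poly p z)) \<le> 1"
      proof (rule mm[OF _ _ that, where h = "\<lambda>z. exp (- poly p z)"])
        show "(\<lambda>z. exp (- poly p z)) holomorphic_on S"
          by (intro holomorphic_intros)
        show "norm (exp (- poly p x)) \<le> 1" if "x \<in> sphere 0 1" for x
          using bd(1)[OF that] \<phi>0[of x] by simp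
      qed
      then show ?thesis by simp
    qed
    have mean: "((\<lambda>t. poly p (cis (2 * pi * t))) has_integral poly p 0) {0..1}"
      by (rule has_integral_mean_value_circle[OF hp])
    have "Re (poly p 0) \<le> I + 2 * \<eta>"
    proof (rule has_integral_le)
      show "((\<lambda>t. Re (poly p (cis (2 * pi * t)))) has_integral Re (poly p 0)) {0..1}"
        using has_integral_linear[OF mean bounded_linear_Re] by (simp add: o_def)
      show "((\<lambda>t. \<phi> (cis (2 * pi * t)) + 2 * \<eta>) has_integral I + 2 * \<eta>) {0..1}"
        using has_integral_add[OF integrable_integral[OF int\<phi>] has_integral_const_real[of "2 * \<eta>" 0 1]]
        by (simp add: I_def)
      show "Re (poly p (cis (2 * pi * t))) \<le> \<phi> (cis (2 * pi * t)) + 2 * \<eta>" for t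
        using bd(2)[of "cis (2 * pi * t)"] by simp
    qed
    \<comment> \<open>Harnack's inequality asks for a strictly positive real part.\<close>
    have *: "Re (poly p w + of_real \<delta>) \<le> 3 * Re (poly p 0 + of_real \<delta>)" if "\<delta> > 0" for \<delta>
    proof (rule Harnack_half_disc[where p = "\<lambda>z. poly p z + of_real \<delta>"])
      show "(\<lambda>z. poly p z + of_real \<delta>) holomorphic_on ball 0 1"
        by (intro holomorphic_intros)
      show "0 < Re (poly p z + of_real \<delta>)" if "norm z < 1" for z
        using nonneg[of z] that \<open>\<delta> > 0\<close> by simp
    qed (rule w)
    have "Re (poly p w) \<le> 3 * Re (poly p 0)"
    proof (rule field_le_epsilon)
      fix e :: real assume "e > 0"
      then show "Re (poly p w) \<le> 3 * Re (poly p 0) + e"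
        using *[of "e / 2"] by simp
    qed
    with \<open>Re (poly p 0) \<le> I + 2 * \<eta>\<close> have "Re (poly p w) \<le> 3 * (I + 2 * \<eta>)" by simp
    then have "exp (Re (poly p w)) \<le> exp (3 * (I + 2 * \<eta>))"
      by simp
    moreover have "norm (f w) \<le> exp (Re (poly p w))"
      using w by (intro exp_le) simp
    ultimately show ?thesis by linarith
  qed
  show ?thesis
  proof (cases "f w = 0")
    case False
    have "ln (norm (f w)) \<le> 3 * I"
    proof (rule field_le_epsilon)
      fix e :: real assume "e > 0"
      then have "ln (norm (f w)) \<le> ln (exp (3 * (I + 2 * (e / 6))))"
        using main[of "e / 6"] False by (intro ln_mono) auto
      then show "ln (norm (f w)) \<le> 3 * I + e" by simp
    qed
    then have "exp (ln (norm (f w))) \<le> exp (3 * I)"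
      by simp
    then show ?thesis
      using False by (simp add: I_def \<phi>_def)
  qed auto
qed

section \<open>Hartogs' theorem: separate holomorphy implies local boundedness\<close>

text \<open>
  Hartogs' lemma turns a pointwise growth bound into a uniform one.  The functions
  \<open>log max(|v\<^sub>n|, 1) / n\<close> are uniformly bounded on the circle and vanish eventually at each of its points,
  so their means tend to \<open>0\<close> by dominated convergence, and these means control \<open>v\<^sub>n\<close> on the half disc.
\<close>

lemma hartogs_lemma_unit_disc:
  fixes v :: "nat \<Rightarrow> complex \<Rightarrow> complex"
  assumes hol: "\<And>n. v n holomorphic_on S" "open S" "cball 0 1 \<subseteq> S"
    and MA: "1 \<le> M" "1 \<le> A"
    and bound: "\<And>n x. x \<in> sphere 0 1 \<Longrightarrow> norm (v n x) \<le> M * A ^ n"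
    and ev: "\<And>x. x \<in> sphere 0 1 \<Longrightarrow> \<forall>\<^sub>F n in sequentially. norm (v n x) \<le> 1"
    and c: "1 < c"
  shows "\<forall>\<^sub>F n in sequentially. \<forall>w. norm w \<le> 1/2 \<longrightarrow> norm (v n w) \<le> c ^ n"
proof -
  define \<phi> where "\<phi> n t = ln (max (norm (v n (cis (2 * pi * t)))) 1) / real n" for n and t :: real
  have cont: "continuous_on {0..1} (\<lambda>t. ln (max (norm (v n (cis (2 * pi * t)))) 1))" for n
  proof -
    have "continuous_on (cball 0 1) (v n)"
      using hol holomorphic_on_imp_continuous_on holomorphic_on_subset by blast
    moreover have "continuous_on {0..1} (\<lambda>t. cis (2 * pi * t))"
      unfolding cis_conv_exp by (intro continuous_intros)
    ultimately have "continuous_on {0..1} (\<lambda>t. v n (cis (2 * pi * t)))"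
      by (rule continuous_on_compose2) auto
    then show ?thesis
      by (intro continuous_intros) auto
  qed
  have int: "\<phi> n integrable_on {0..1}" for n
  proof (cases "n = 0")
    case False
    then show ?thesis
      unfolding \<phi>_def by (intro integrable_continuous_interval continuous_intros cont) simp
  next
    case True
    then have "\<phi> n = (\<lambda>t. 0)" by (simp add: \<phi>_def fun_eq_iff)
    then show ?thesis by (simp add: integrable_0)
  qed
  have le: "norm (\<phi> n t) \<le> ln M + ln A" for n t
  proof (cases "n = 0")
    case False
    have "1 \<le> M * A ^ n"
      using MA mult_mono[of 1 M 1 "A ^ n"] by (simp add: one_le_power)
    then have "ln (max (norm (v n (cis (2 * pi * t)))) 1) \<le> ln (M * A ^ n)"
      using bound[of "cis (2 * pi * t)" n] by (intro ln_mono) auto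
    also have "\<dots> = ln M + real n * ln A"
      using MA by (simp add: ln_mult ln_realpow)
    also have "\<dots> \<le> real n * (ln M + ln A)"
      using False MA mult_right_mono[of 1 "real n" "ln M"] by (simp add: algebra_simps)
    finally show ?thesis
      using False by (simp add: \<phi>_def field_simps)
  qed (use MA in \<open>simp add: \<phi>_def\<close>)
  have conv: "(\<lambda>n. \<phi> n t) \<longlonglongrightarrow> 0" for t
  proof (rule tendsto_eventually)
    have "\<forall>\<^sub>F n in sequentially. norm (v n (cis (2 * pi * t))) \<le> 1"
      by (rule ev) simp
    then show "\<forall>\<^sub>F n in sequentially. \<phi> n t = 0"
      by eventually_elim (simp add: \<phi>_def max_absorb2)
  qed
  have "(\<lambda>n. integral {0..1} (\<phi> n)) \<longlonglongrightarrow> integral {0..1} (\<lambda>t::real. 0 :: real)"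
    by (rule dominated_convergence(2)[where h = "\<lambda>_. ln M + ln A"])
       (use int le conv in auto)
  then have "\<forall>\<^sub>F n in sequentially. integral {0..1} (\<phi> n) < ln c / 3"
    using c by (intro order_tendstoD(2)) auto
  then show ?thesis
    using eventually_gt_at_top[of 0]
  proof eventually_elim
    case (elim n)
    show ?case
    proof (intro allI impI)
      fix w :: complex assume w: "norm w \<le> 1/2"
      have "norm (v n w) \<le> exp (3 * integral {0..1} (\<lambda>t. ln (max (norm (v n (cis (2 * pi * t)))) 1)))"
        by (rule norm_le_exp_mean_log[OF hol w])
      also have "(\<lambda>t. ln (max (norm (v n (cis (2 * pi * t)))) 1)) = (\<lambda>t. real n * \<phi> n t)"
        using elim by (simp add: \<phi>_def)
      also have "integral {0..1} (\<lambda>t. real n * \<phi> n t) = real n * integral {0..1} (\<phi> n)"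
        by (rule integral_mult_right)
      also have "3 * (real n * integral {0..1} (\<phi> n)) \<le> real n * ln c"
        using elim by simp
      also have "exp (real n * ln c) = c ^ n"
        using c by (simp add: exp_of_nat_mult)
      finally show "norm (v n w) \<le> c ^ n" by simp
    qed
  qed
qed

text \<open>
  By Montel's theorem a subsequence converges to a holomorphic function, which can only be \<open>f\<close>.
\<close>

lemma holomorphic_on_bounded_pointwise_limit:
  assumes S: "open S" and hol: "\<And>n. F n holomorphic_on S"
    and bound: "\<And>n z. z \<in> S \<Longrightarrow> norm (F n z :: complex) \<le> B"
    and lim: "\<And>z. z \<in> S \<Longrightarrow> (\<lambda>n. F n z) \<longlonglongrightarrow> f z"
  shows "f holomorphic_on S"
proof -
  have locally_bounded: "\<exists>B. \<forall>h\<in>range F. \<forall>z\<in>K. norm (h z) \<le> B" if "K \<subseteq> S" for K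
    using that bound by blast
  obtain g r where g: "g holomorphic_on S" "strict_mono (r :: nat \<Rightarrow> nat)"
      "\<And>x. x \<in> S \<Longrightarrow> (\<lambda>n. F (r n) x) \<longlonglongrightarrow> g x"
  proof (rule Montel[OF S, of "range F" F])
    show "h holomorphic_on S" if "h \<in> range F" for h
      using that hol by blast
  qed (use locally_bounded in auto)
  have "f x = g x" if "x \<in> S" for x
    using LIMSEQ_subseq_LIMSEQ[OF lim[OF that] g(2)] g(3)[OF that]
    by (auto simp: o_def intro: LIMSEQ_unique)
  then show ?thesis
    using g(1) by (subst holomorphic_cong[OF refl, of S f g]) auto
qed

text \<open>
  Holomorphic dependence on the parameter \<open>w\<close> passes to the derivative in \<open>z\<close> because the difference
  quotients are bounded uniformly in \<open>w\<close> by Cauchy's estimate and converge pointwise.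
\<close>

lemma deriv_bounded_separately_holomorphic:
  assumes A: "open A"
    and hol1: "\<And>z. z \<in> ball b r \<Longrightarrow> (\<lambda>w. f w z) holomorphic_on A"
    and hol2: "\<And>w. w \<in> A \<Longrightarrow> f w holomorphic_on ball b r"
    and bound: "\<And>w z. w \<in> A \<Longrightarrow> z \<in> ball b r \<Longrightarrow> norm (f w z :: complex) \<le> M"
    and s: "s < r"
  shows "\<And>z. z \<in> ball b s \<Longrightarrow> (\<lambda>w. deriv (f w) z) holomorphic_on A"
    and "\<And>w z. w \<in> A \<Longrightarrow> z \<in> ball b s \<Longrightarrow> norm (deriv (f w) z) \<le> 2 * M / (r - s)"
proof -
  show dbound: "norm (deriv (f w) z) \<le> 2 * M / (r - s)" if w: "w \<in> A" and z: "z \<in> ball b s" for w z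
  proof -
    have sub: "cball z ((r - s) / 2) \<subseteq> ball b r"
    proof
      fix x assume "x \<in> cball z ((r - s) / 2)"
      moreover have "dist b x \<le> dist b z + dist z x" by (rule dist_triangle)
      ultimately show "x \<in> ball b r" using z s by (simp add: field_simps)
    qed
    have "norm ((deriv ^^ 1) (f w) z) \<le> fact 1 * M / ((r - s) / 2) ^ 1"
    proof (rule Cauchy_inequality)
      show "f w holomorphic_on ball z ((r - s) / 2)"
        using hol2[OF w] sub ball_subset_cball by (metis holomorphic_on_subset order_trans)
      show "continuous_on (cball z ((r - s) / 2)) (f w)"
        using hol2[OF w] sub by (metis holomorphic_on_subset holomorphic_on_imp_continuous_on)
      show "norm (f w x) \<le> M" if "norm (z - x) = (r - s) / 2" for x
        using subsetD[OF sub, of x] that by (intro bound w) (simp_all add: dist_norm)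
    qed (use s in simp)
    then show ?thesis by (simp add: mult.commute)
  qed
  fix z assume z: "z \<in> ball b s"
  obtain e where e: "e > 0" "ball z e \<subseteq> ball b s"
    using z open_ball open_contains_ball by metis
  define h :: "nat \<Rightarrow> complex" where "h n = of_real (e / real (Suc (Suc n)))" for n
  have h0: "h n \<noteq> 0" for n using e by (simp add: h_def del: of_nat_Suc)
  have hs: "z + h n \<in> ball b s" for n
  proof -
    have "norm (h n) < e"
      using e by (simp only: h_def norm_of_real) (simp add: divide_less_eq)
    then have "z + h n \<in> ball z e" by (simp add: dist_norm)
    then show ?thesis using e(2) by blast
  qed
  have hlim: "h \<longlonglongrightarrow> 0"
  proof -
    have "(\<lambda>n. e / real n) \<longlonglongrightarrow> 0" by (rule lim_const_over_n)
    then have "(\<lambda>n. e / real (Suc (Suc n))) \<longlonglongrightarrow> 0"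
      by (intro LIMSEQ_Suc[of "\<lambda>n. e / real (Suc n)"] LIMSEQ_Suc[of "\<lambda>n. e / real n"])
    then show ?thesis
      unfolding h_def using tendsto_of_real[of _ 0 sequentially, where 'a = complex] by fastforce
  qed
  have sr: "ball b s \<subseteq> ball b r" using s by (simp add: subset_ball)
  have der: "(f w has_field_derivative deriv (f w) x) (at x)" if "w \<in> A" "x \<in> ball b s" for w x
    by (rule holomorphic_derivI[OF hol2[OF that(1)] open_ball subsetD[OF sr that(2)]])
  show "(\<lambda>w. deriv (f w) z) holomorphic_on A"
  proof (rule holomorphic_on_bounded_pointwise_limit[OF A])
    show "(\<lambda>w. (f w (z + h n) - f w z) / h n) holomorphic_on A" for n
      using hs[of n] z sr h0[of n] by (intro holomorphic_intros hol1) auto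
    show "norm ((f w (z + h n) - f w z) / h n) \<le> 2 * M / (r - s)" if w: "w \<in> A" for n w
    proof -
      have "norm (f w (z + h n) - f w z) \<le> 2 * M / (r - s) * norm (z + h n - z)"
        by (rule field_differentiable_bound[where S = "ball b s" and f' = "deriv (f w)"])
           (use der dbound hs z w in \<open>auto intro: has_field_derivative_at_within simp del: mem_ball\<close>)
      then show ?thesis
        using h0[of n] by (simp add: norm_divide divide_le_eq)
    qed
    show "(\<lambda>n. (f w (z + h n) - f w z) / h n) \<longlonglongrightarrow> deriv (f w) z" if w: "w \<in> A" for w
    proof -
      have "(\<lambda>u. (f w (z + u) - f w z) / u) \<midarrow>0\<rightarrow> deriv (f w) z"
        using der[OF w z] by (simp add: DERIV_def)
      moreover have "filterlim h (at 0) sequentially"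
        using hlim h0 by (simp add: filterlim_at)
      ultimately show ?thesis
        by (rule filterlim_compose)
    qed
  qed
qed

lemma higher_deriv_bounded_separately_holomorphic:
  assumes A: "open A"
    and "\<And>z. z \<in> ball b r \<Longrightarrow> (\<lambda>w. f w z) holomorphic_on A"
    and "\<And>w. w \<in> A \<Longrightarrow> f w holomorphic_on ball b r"
    and "\<And>w z. w \<in> A \<Longrightarrow> z \<in> ball b r \<Longrightarrow> norm (f w z :: complex) \<le> M"
    and "z \<in> ball b r"
  shows "(\<lambda>w. (deriv ^^ n) (f w) z) holomorphic_on A"
  using assms(2-)
proof (induction n arbitrary: f r M)
  case 0
  then show ?case by simp
next
  case (Suc n)
  obtain s where s: "dist b z < s" "s < r"
    using Suc.prems(4) dense by auto
  note d = deriv_bounded_separately_holomorphic[OF A Suc.prems(1-3) s(2)]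
  have "(\<lambda>w. (deriv ^^ n) (deriv (f w)) z) holomorphic_on A"
  proof (rule Suc.IH)
    show "deriv (f w) holomorphic_on ball b s" if "w \<in> A" for w
      using Suc.prems(2)[OF that] s(2)
      by (meson holomorphic_deriv holomorphic_on_subset less_imp_le open_ball subset_ball)
  qed (use d s in auto)
  then show ?case by (simp add: funpow_swap1)
qed

text \<open>
  For each \<open>z\<close> the function \<open>w \<mapsto> f w z\<close> is bounded on the closed disc of radius \<open>2\<close>.  The sets of those
  \<open>z\<close> for which \<open>n\<close> is a bound are closed and cover the disc of radius \<open>1/4\<close>, so by Baire's theorem one
  of them contains a disc.
\<close>

lemma separately_holomorphic_bounded_somewhere:
  assumes hol1: "\<And>z. z \<in> ball 0 3 \<Longrightarrow> (\<lambda>w. f w z) holomorphic_on ball 0 3"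
    and hol2: "\<And>w. w \<in> ball 0 3 \<Longrightarrow> f w holomorphic_on ball 0 3"
  obtains z1 :: complex and r M :: real
  where "r > 0" "ball z1 r \<subseteq> cball 0 (1/4)"
    "\<And>w z. w \<in> cball 0 2 \<Longrightarrow> z \<in> ball z1 r \<Longrightarrow> norm (f w z :: complex) \<le> M"
proof -
  define F where "F n = (\<Inter>w\<in>cball 0 2. cball 0 (1/4) \<inter> f w -` cball 0 (real n))" for n
  have "closed (F n)" for n
    unfolding F_def
  proof (intro closed_INT ballI continuous_closed_preimage)
    fix w :: complex assume "w \<in> cball 0 2"
    then have "f w holomorphic_on ball 0 3" by (intro hol2) auto
    then show "continuous_on (cball 0 (1/4)) (f w)"
      by (rule holomorphic_on_imp_continuous_on[OF holomorphic_on_subset]) auto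
  qed auto
  have cover: "\<exists>n. z \<in> F n" if z: "z \<in> cball 0 (1/4)" for z
  proof -
    have "continuous_on (cball 0 2) (\<lambda>w. f w z)"
      using hol1[of z] z by (intro holomorphic_on_imp_continuous_on[OF holomorphic_on_subset]) auto
    then have "bounded ((\<lambda>w. f w z) ` cball 0 2)"
      by (intro compact_imp_bounded compact_continuous_image) auto
    then obtain B where B: "\<And>w. w \<in> cball 0 2 \<Longrightarrow> norm (f w z) \<le> B"
      unfolding bounded_iff by blast
    obtain n where n: "B \<le> real n" using real_arch_simple by blast
    have "norm (f w z) \<le> real n" if "w \<in> cball 0 2" for w
      using B[OF that] n by linarith
    then have "z \<in> F n" using z by (simp add: F_def)
    then show ?thesis ..
  qed
  have "\<exists>n. interior (F n) \<noteq> {}"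
  proof (rule ccontr)
    assume "\<not> ?thesis"
    then have dense: "closure (- F n) = UNIV" for n
      by (simp add: closure_complement)
    have "UNIV \<subseteq> closure (\<Inter>n. - F n)"
      by (rule Baire) (use \<open>\<And>n. closed (F n)\<close> dense in auto)
    then have "0 \<in> closure (\<Inter>n. - F n)" by blast
    then obtain z where z: "z \<in> (\<Inter>n. - F n)" "dist z 0 < 1/4"
      unfolding closure_approachable by (metis zero_less_divide_1_iff zero_less_numeral)
    then have "z \<in> cball 0 (1/4)" by simp
    from cover[OF this] z(1) show False by blast
  qed
  then obtain n z1 where "z1 \<in> interior (F n)" by blast
  then obtain r where r: "r > 0" "ball z1 r \<subseteq> F n"
    unfolding mem_interior by blast
  show thesis
  proof
    have "F n \<subseteq> cball 0 (1/4)"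
      unfolding F_def by (rule INF_lower2[of 0]) auto
    with r(2) show "ball z1 r \<subseteq> cball 0 (1/4)" by blast
    show "norm (f w z) \<le> real n" if "w \<in> cball 0 2" "z \<in> ball z1 r" for w z
      using subsetD[OF r(2) that(2)] that(1) by (simp add: F_def)
  qed (rule r(1))
qed

text \<open>
  Expand \<open>f w\<close> in powers of \<open>z - z1\<close>, where \<open>z1\<close> is the centre of a disc, possibly very small, on which
  \<open>f\<close> is bounded uniformly in \<open>w\<close>.  The coefficients \<open>v\<^sub>n w\<close> are holomorphic in \<open>w\<close> and grow at most
  geometrically.  For each fixed \<open>w\<close> the series converges for \<open>|z - z1| < 2\<close>, so \<open>|v\<^sub>n w| \<le> 1\<close> for large \<open>n\<close>.  Hartogs'
  lemma makes the bound \<open>|v\<^sub>n w| \<le> C 2\<^sup>n\<close> uniform in \<open>w\<close>; as \<open>|z1| \<le> 1/4\<close>, every \<open>z\<close> with \<open>|z| < 1/8\<close> satisfies \<open>|z - z1| \<le> 3/8\<close>, and the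
  series is dominated by a geometric series of ratio \<open>3/4\<close>.
\<close>

theorem separately_holomorphic_locally_bounded:
  fixes f :: "complex \<Rightarrow> complex \<Rightarrow> complex"
  assumes hol1: "\<And>z. z \<in> ball 0 3 \<Longrightarrow> (\<lambda>w. f w z) holomorphic_on ball 0 3"
    and hol2: "\<And>w. w \<in> ball 0 3 \<Longrightarrow> f w holomorphic_on ball 0 3"
  shows "\<exists>B. \<forall>w\<in>cball 0 (1/2). \<forall>z\<in>ball 0 (1/8). norm (f w z) \<le> B"
proof -
  obtain z1 r M0 where r: "r > 0" "ball z1 r \<subseteq> cball 0 (1/4)"
    and M0: "\<And>w z. w \<in> cball 0 2 \<Longrightarrow> z \<in> ball z1 r \<Longrightarrow> norm (f w z) \<le> M0"
    using separately_holomorphic_bounded_somewhere[where f = f, OF hol1 hol2] by metis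
  have z1: "norm z1 \<le> 1/4"
    using subsetD[OF r(2), of z1] r(1) by simp
  have sub: "cball z1 (3/2) \<subseteq> ball 0 3"
  proof
    fix x assume "x \<in> cball z1 (3/2)"
    moreover have "norm x \<le> norm z1 + norm (z1 - x)"
      using norm_triangle_ineq4[of z1 "z1 - x"] by simp
    ultimately show "x \<in> ball 0 3" using z1 by (simp add: dist_norm)
  qed
  define v where "v n w = (deriv ^^ n) (f w) z1 / fact n" for n w
  define M where "M = max M0 1"
  define A where "A = max (2 / r) 1"
  have MA: "1 \<le> M" "1 \<le> A" by (simp_all add: M_def A_def)
  have hol2': "f w holomorphic_on cball z1 (3/2)" if "w \<in> ball 0 3" for w
    using hol2[OF that] sub by (rule holomorphic_on_subset)
  have subr: "cball z1 (r/2) \<subseteq> ball z1 r" "ball z1 r \<subseteq> ball 0 3"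
    using r by auto
  have cauchy: "norm (v n w) \<le> B / \<rho> ^ n"
    if "0 < \<rho>" "f w holomorphic_on cball z1 \<rho>" "\<And>x. x \<in> cball z1 \<rho> \<Longrightarrow> norm (f w x) \<le> B" for n w B \<rho>
  proof -
    have "norm ((deriv ^^ n) (f w) z1) \<le> fact n * B / \<rho> ^ n"
    proof (rule Cauchy_inequality[OF _ holomorphic_on_imp_continuous_on[OF that(2)] that(1)])
      show "f w holomorphic_on ball z1 \<rho>"
        using that(2) ball_subset_cball by (rule holomorphic_on_subset)
      show "norm (f w x) \<le> B" if "norm (z1 - x) = \<rho>" for x
        using that by (intro \<open>\<And>x. x \<in> cball z1 \<rho> \<Longrightarrow> norm (f w x) \<le> B\<close>) (simp add: dist_norm)
    qed
    then show ?thesis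
      by (simp add: v_def norm_divide divide_le_eq mult.commute)
  qed
  have vbound: "norm (v n w) \<le> M * A ^ n" if w: "w \<in> cball 0 2" for n w
  proof -
    have "norm (v n w) \<le> M / (r / 2) ^ n"
    proof (rule cauchy)
      have "f w holomorphic_on ball 0 3" using w by (intro hol2) auto
      then show "f w holomorphic_on cball z1 (r / 2)"
        using subr by (meson holomorphic_on_subset order_trans)
      show "norm (f w x) \<le> M" if "x \<in> cball z1 (r / 2)" for x
        using M0[OF w subsetD[OF subr(1) that]] by (simp add: M_def)
    qed (use r in simp)
    also have "\<dots> = M * (2 / r) ^ n"
      by (simp add: power_divide)
    also have "\<dots> \<le> M * A ^ n"
      using MA r by (intro mult_left_mono power_mono) (auto simp: A_def)
    finally show ?thesis .
  qed
  have hol: "v n holomorphic_on ball 0 2" for n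
    unfolding v_def
  proof (intro holomorphic_intros higher_deriv_bounded_separately_holomorphic)
    show "(\<lambda>w. f w z) holomorphic_on ball 0 2" if "z \<in> ball z1 r" for z
      by (rule holomorphic_on_subset[OF hol1]) (use that subr in auto)
    show "f w holomorphic_on ball z1 r" if "w \<in> ball 0 2" for w
      by (rule holomorphic_on_subset[OF hol2 subr(2)]) (use that in auto)
    show "norm (f w z) \<le> M0" if "w \<in> ball 0 2" "z \<in> ball z1 r" for w z
      using M0[of w z] that by simp
    show "z1 \<in> ball z1 r" using r by simp
  qed auto
  have "\<forall>\<^sub>F n in sequentially. \<forall>w. norm w \<le> 1/2 \<longrightarrow> norm (v n w) \<le> 2 ^ n"
  proof (rule hartogs_lemma_unit_disc[OF hol _ _ MA])
    show "norm (v n x) \<le> M * A ^ n" if "x \<in> sphere 0 1" for n x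
      using that by (intro vbound) auto
    show "\<forall>\<^sub>F n in sequentially. norm (v n x) \<le> 1" if x: "x \<in> sphere 0 1" for x
    proof -
      have hx: "f x holomorphic_on cball z1 (3/2)"
        using x by (intro hol2') auto
      then have "bounded (f x ` cball z1 (3/2))"
        by (intro compact_imp_bounded compact_continuous_image holomorphic_on_imp_continuous_on) auto
      then obtain B where B: "\<And>z. z \<in> cball z1 (3/2) \<Longrightarrow> norm (f x z) \<le> B"
        unfolding bounded_iff by blast
      have "(\<lambda>n. B * (2/3) ^ n) \<longlonglongrightarrow> B * 0"
        by (intro tendsto_mult tendsto_const LIMSEQ_power_zero) simp
      then have "\<forall>\<^sub>F n in sequentially. B * (2/3) ^ n < 1"
        by (intro order_tendstoD) auto
      then show ?thesis
      proof eventually_elim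
        case (elim n)
        have "norm (v n x) \<le> B / (3/2) ^ n"
          by (rule cauchy[OF _ hx B]) simp_all
        also have "\<dots> = B * (2/3) ^ n"
          by (simp add: power_divide)
        finally show ?case using elim by simp
      qed
    qed
  qed auto
  then obtain n0 where n0: "\<And>n w. n \<ge> n0 \<Longrightarrow> norm w \<le> 1/2 \<Longrightarrow> norm (v n w) \<le> 2 ^ n"
    unfolding eventually_sequentially by blast
  define C where "C = M * A ^ n0"
  have C1: "1 \<le> C"
    using MA mult_mono[of 1 M 1 "A ^ n0"] by (simp add: C_def one_le_power)
  have vC: "norm (v n w) \<le> C * 2 ^ n" if w: "norm w \<le> 1/2" for n w
  proof (cases "n0 \<le> n")
    case True
    have "norm (v n w) \<le> 1 * 2 ^ n"
      using n0[OF True w] by simp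
    also have "\<dots> \<le> C * 2 ^ n"
      using C1 by (intro mult_right_mono) auto
    finally show ?thesis .
  next
    case False
    have "norm (v n w) \<le> M * A ^ n"
      using w by (intro vbound) auto
    also have "\<dots> \<le> C"
      unfolding C_def using MA False by (intro mult_left_mono power_increasing) auto
    also have "\<dots> \<le> C * 2 ^ n"
      using C1 mult_left_mono[of 1 "2 ^ n" C] by simp
    finally show ?thesis .
  qed
  have "norm (f w z) \<le> 4 * C" if w: "w \<in> cball 0 (1/2)" and z: "z \<in> ball 0 (1/8)" for w z
  proof -
    have zz1: "norm (z - z1) \<le> 3/8"
      using norm_triangle_ineq4[of z z1] z z1 by simp
    have "(\<lambda>n. v n w * (z - z1) ^ n) sums f w z"
      unfolding v_def
    proof (rule holomorphic_power_series)
      show "f w holomorphic_on ball z1 (3/2)"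
        by (rule holomorphic_on_subset[OF hol2']) (use w in auto)
      show "z \<in> ball z1 (3/2)" using zz1 by (simp add: dist_norm norm_minus_commute)
    qed
    moreover have "norm (\<Sum>n. v n w * (z - z1) ^ n) \<le> (\<Sum>n. C * (3/4) ^ n)"
    proof (rule norm_suminf_le)
      fix n
      have "norm (v n w * (z - z1) ^ n) \<le> (C * 2 ^ n) * (3/8) ^ n"
        unfolding norm_mult norm_power using w zz1 C1
        by (intro mult_mono power_mono vC) auto
      also have "\<dots> = C * (3/4) ^ n"
        by (simp flip: power_mult_distrib)
      finally show "norm (v n w * (z - z1) ^ n) \<le> C * (3/4) ^ n" .
    qed (intro summable_mult summable_geometric, simp)
    moreover have "(\<Sum>n. C * (3/4) ^ n) = 4 * C"
      by (subst suminf_mult) (auto simp: suminf_geometric summable_geometric)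
    ultimately show ?thesis by (simp add: sums_iff)
  qed
  then show ?thesis by blast
qed

section \<open>Geometry of Hilbert spaces of functions\<close>

text \<open>
  The locale treats scalar and vector valued functions at once.  Scalars act through an arbitrary
  complex module structure on the value space.
\<close>

locale hilbert_functions = module scl for scl :: "complex \<Rightarrow> 'v::ab_group_add \<Rightarrow> 'v" +
  fixes \<Omega> :: "'a set" and S :: "('a, 'v) function_space"
  assumes hilbert: "hilbert_function_space scl \<Omega> S"
begin

lemma elems_outside: "f \<in> elems S \<Longrightarrow> z \<notin> \<Omega> \<Longrightarrow> f z = 0"
  and elems_zero: "(\<lambda>z. 0) \<in> elems S"
  and elems_add: "f \<in> elems S \<Longrightarrow> g \<in> elems S \<Longrightarrow> (\<lambda>z. f z + g z) \<in> elems S"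
  and elems_scl: "f \<in> elems S \<Longrightarrow> (\<lambda>z. scl c (f z)) \<in> elems S"
  and form_add: "f \<in> elems S \<Longrightarrow> g \<in> elems S \<Longrightarrow> h \<in> elems S \<Longrightarrow>
      form S (\<lambda>z. f z + g z) h = form S f h + form S g h"
  and form_scl: "f \<in> elems S \<Longrightarrow> h \<in> elems S \<Longrightarrow>
      form S (\<lambda>z. scl c (f z)) h = c * form S f h"
  and form_commute: "f \<in> elems S \<Longrightarrow> g \<in> elems S \<Longrightarrow> form S g f = cnj (form S f g)"
  and form_self_nonneg: "f \<in> elems S \<Longrightarrow> form S f f \<in> \<real>\<^sub>\<ge>\<^sub>0"
  and form_self_eq_0: "f \<in> elems S \<Longrightarrow> form S f f = 0 \<Longrightarrow> f = (\<lambda>z. 0)"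
  using hilbert unfolding hilbert_function_space_def by blast+

lemma form_cnj: "f \<in> elems S \<Longrightarrow> g \<in> elems S \<Longrightarrow> cnj (form S f g) = form S g f"
  by (simp add: form_commute[of f g])

lemma complete:
  assumes "\<And>k. F k \<in> elems S"
    and "\<And>\<epsilon>. \<epsilon> > 0 \<Longrightarrow> \<exists>N. \<forall>k\<ge>N. \<forall>l\<ge>N. fnorm S (\<lambda>z. F k z - F l z) < \<epsilon>"
  shows "\<exists>f\<in>elems S. (\<lambda>k. fnorm S (\<lambda>z. F k z - f z)) \<longlonglongrightarrow> 0"
proof -
  have "\<forall>F::nat \<Rightarrow> 'a \<Rightarrow> 'v.
        (\<forall>k. F k \<in> elems S) \<and>
        (\<forall>\<epsilon>>0. \<exists>N. \<forall>k\<ge>N. \<forall>l\<ge>N. fnorm S (\<lambda>z. F k z - F l z) < \<epsilon>) \<longrightarrow>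
        (\<exists>f\<in>elems S. (\<lambda>k. fnorm S (\<lambda>z. F k z - f z)) \<longlonglongrightarrow> 0)"
    using hilbert unfolding hilbert_function_space_def by (elim conjE)
  from spec[OF this, of F] show ?thesis
    by (rule mp) (intro conjI allI impI assms)
qed

lemma elems_diff: "f \<in> elems S \<Longrightarrow> g \<in> elems S \<Longrightarrow> (\<lambda>z. f z - g z) \<in> elems S"
  using elems_add[OF _ elems_scl[of g "-1"], of f] by simp

lemma elems_sum: "(\<And>j. j \<in> X \<Longrightarrow> u j \<in> elems S) \<Longrightarrow> (\<lambda>z. \<Sum>j\<in>X. u j z) \<in> elems S"
  by (induction X rule: infinite_finite_induct) (auto intro: elems_zero elems_add)

lemma form_diff:
  assumes "f \<in> elems S" "g \<in> elems S" "h \<in> elems S"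
  shows "form S (\<lambda>z. f z - g z) h = form S f h - form S g h"
  using form_add[OF assms(1) elems_scl[OF assms(2), of "-1"] assms(3)]
    form_scl[OF assms(2,3), of "-1"] by simp

lemma form_zero: "h \<in> elems S \<Longrightarrow> form S (\<lambda>z. 0) h = 0"
  using form_scl[OF elems_zero, of h 0] by simp

lemma form_sum:
  assumes "\<And>j. j \<in> X \<Longrightarrow> u j \<in> elems S" "h \<in> elems S"
  shows "form S (\<lambda>z. \<Sum>j\<in>X. u j z) h = (\<Sum>j\<in>X. form S (u j) h)"
  using assms
  by (induction X rule: infinite_finite_induct) (simp_all add: form_zero form_add elems_sum)

lemma form_add_right:
  assumes "f \<in> elems S" "g \<in> elems S" "h \<in> elems S"
  shows "form S h (\<lambda>z. f z + g z) = form S h f + form S h g"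
proof -
  have "cnj (form S (\<lambda>z. f z + g z) h) = cnj (form S f h) + cnj (form S g h)"
    using assms by (simp add: form_add)
  then show ?thesis using assms by (simp add: form_cnj elems_add)
qed

lemma form_scl_right:
  assumes "f \<in> elems S" "h \<in> elems S"
  shows "form S h (\<lambda>z. scl c (f z)) = cnj c * form S h f"
proof -
  have "cnj (form S (\<lambda>z. scl c (f z)) h) = cnj c * cnj (form S f h)"
    using assms by (simp add: form_scl)
  then show ?thesis using assms by (simp add: form_cnj elems_scl)
qed

lemma form_diff_right:
  assumes "f \<in> elems S" "g \<in> elems S" "h \<in> elems S"
  shows "form S h (\<lambda>z. f z - g z) = form S h f - form S h g"
proof -
  have "cnj (form S (\<lambda>z. f z - g z) h) = cnj (form S f h) - cnj (form S g h)"
    using assms by (simp add: form_diff)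
  then show ?thesis using assms by (simp add: form_cnj elems_diff)
qed

lemma form_sum_right:
  assumes "\<And>j. j \<in> X \<Longrightarrow> u j \<in> elems S" "h \<in> elems S"
  shows "form S h (\<lambda>z. \<Sum>j\<in>X. u j z) = (\<Sum>j\<in>X. form S h (u j))"
proof -
  have "cnj (form S (\<lambda>z. \<Sum>j\<in>X. u j z) h) = (\<Sum>j\<in>X. cnj (form S (u j) h))"
    using assms by (simp add: form_sum)
  then show ?thesis using assms by (simp add: form_cnj elems_sum)
qed

lemma fnorm_nonneg: "f \<in> elems S \<Longrightarrow> 0 \<le> fnorm S f"
  using form_self_nonneg[of f] by (auto simp: fnorm_def complex_nonneg_Reals_iff)

lemma form_self: "f \<in> elems S \<Longrightarrow> form S f f = of_real ((fnorm S f)\<^sup>2)"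
  using form_self_nonneg[of f] by (auto simp: fnorm_def complex_nonneg_Reals_iff complex_eq_iff)

lemma fnorm_power2: "f \<in> elems S \<Longrightarrow> (fnorm S f)\<^sup>2 = Re (form S f f)"
  by (simp add: form_self)

lemma fnorm_eq_0: "f \<in> elems S \<Longrightarrow> fnorm S f = 0 \<Longrightarrow> f = (\<lambda>z. 0)"
  by (rule form_self_eq_0) (simp_all add: form_self)

lemma fnorm_zero: "fnorm S (\<lambda>z. 0) = 0"
  by (simp add: fnorm_def form_zero elems_zero)

lemma Cauchy_Schwarz_form:
  assumes f: "f \<in> elems S" and g: "g \<in> elems S"
  shows "norm (form S f g) \<le> fnorm S f * fnorm S g"
proof (cases "fnorm S g = 0")
  case True
  then have "form S f g = cnj (form S (\<lambda>z. 0) f)"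
    using fnorm_eq_0[OF g] f g by (simp add: form_cnj)
  then show ?thesis using True f by (simp add: form_zero)
next
  case False
  define N where "N = (fnorm S g)\<^sup>2"
  define t where "t = form S f g / of_real N"
  have N: "N > 0" using False by (simp add: N_def)
  have gg: "form S g g = of_real N" by (simp add: form_self g N_def)
  have gf: "form S g f = cnj (form S f g)" by (simp add: form_cnj f g)
  have "form S (\<lambda>z. f z - scl t (g z)) (\<lambda>z. f z - scl t (g z)) =
      form S f f - form S f g * cnj (form S f g) / of_real N"
    using N by (simp add: form_diff form_diff_right form_scl form_scl_right elems_diff elems_scl f g
        gg gf t_def field_simps)
  also have "\<dots> = of_real ((fnorm S f)\<^sup>2 - (norm (form S f g))\<^sup>2 / N)"
    by (simp add: form_self f complex_norm_square[symmetric])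
  finally have "complex_of_real ((fnorm S f)\<^sup>2 - (norm (form S f g))\<^sup>2 / N) \<in> \<real>\<^sub>\<ge>\<^sub>0"
    using form_self_nonneg[OF elems_diff[OF f elems_scl[OF g]], of t] by (simp only:)
  then have "(norm (form S f g))\<^sup>2 \<le> (fnorm S f * fnorm S g)\<^sup>2"
    using N by (simp add: N_def power_mult_distrib field_simps complex_nonneg_Reals_iff)
  then show ?thesis
    by (rule power2_le_imp_le) (simp add: fnorm_nonneg f g)
qed

lemma form_tendsto:
  assumes F: "\<And>n. F n \<in> elems S" and f: "f \<in> elems S" and u: "u \<in> elems S"
    and lim: "(\<lambda>n. fnorm S (\<lambda>z. F n z - f z)) \<longlonglongrightarrow> 0"
  shows "(\<lambda>n. form S (F n) u) \<longlonglongrightarrow> form S f u"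
proof (rule LIM_zero_cancel, rule Lim_null_comparison)
  show "\<forall>\<^sub>F n in sequentially. norm (form S (F n) u - form S f u) \<le> fnorm S (\<lambda>z. F n z - f z) * fnorm S u"
    using Cauchy_Schwarz_form[OF elems_diff[OF F f] u] by (simp add: form_diff F f u)
  show "(\<lambda>n. fnorm S (\<lambda>z. F n z - f z) * fnorm S u) \<longlonglongrightarrow> 0"
    using tendsto_mult[OF lim tendsto_const] by simp
qed

lemma fnorm_triangle:
  assumes f: "f \<in> elems S" and g: "g \<in> elems S"
  shows "fnorm S f \<le> fnorm S (\<lambda>z. f z - g z) + fnorm S g"
proof (rule power2_le_imp_le)
  let ?d = "\<lambda>z. f z - g z"
  have d: "?d \<in> elems S" using f g by (rule elems_diff)
  have "(fnorm S f)\<^sup>2 = Re (form S (\<lambda>z. ?d z + g z) (\<lambda>z. ?d z + g z))"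
    using f by (simp add: fnorm_power2)
  also have "\<dots> = (fnorm S ?d)\<^sup>2 + (fnorm S g)\<^sup>2 + Re (form S ?d g) + Re (form S g ?d)"
    unfolding form_add[OF d g elems_add[OF d g]] form_add_right[OF d g d] form_add_right[OF d g g]
    by (simp add: fnorm_power2 d g)
  also have "Re (form S ?d g) \<le> fnorm S ?d * fnorm S g"
    using Cauchy_Schwarz_form[OF d g] complex_Re_le_cmod order_trans by blast
  also have "Re (form S g ?d) \<le> fnorm S ?d * fnorm S g"
    using Cauchy_Schwarz_form[OF g d] complex_Re_le_cmod[of "form S g ?d"] by (simp add: mult.commute)
  finally show "(fnorm S f)\<^sup>2 \<le> (fnorm S ?d + fnorm S g)\<^sup>2"
    by (simp add: power2_sum algebra_simps)
  show "0 \<le> fnorm S ?d + fnorm S g"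
    using d g by (simp add: fnorm_nonneg)
qed

text \<open>
  The Riesz representation theorem.  The functional is given by its graph \<open>P\<close> over a subspace that need
  not be closed; the bound makes \<open>P\<close> single valued, so no choice of coefficients enters.  The representing vector
  minimises \<open>\<parallel>v\<parallel>\<^sup>2 - 2 Re l\<close>, which is bounded below by \<open>-C\<^sup>2\<close>, and therefore lies in the closure of the subspace; this
  is recorded by the sequence \<open>w\<close> and yields density statements.
\<close>

theorem riesz_pairs:
  fixes P :: "(('a \<Rightarrow> 'v) \<times> complex) set"
  assumes P: "\<And>v l. (v, l) \<in> P \<Longrightarrow> v \<in> elems S" and "P \<noteq> {}"
    and add: "\<And>v l v' l'. (v, l) \<in> P \<Longrightarrow> (v', l') \<in> P \<Longrightarrow> ((\<lambda>z. v z + v' z), l + l') \<in> P"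
    and scl: "\<And>v l c. (v, l) \<in> P \<Longrightarrow> ((\<lambda>z. scl c (v z)), c * l) \<in> P"
    and bound: "\<And>v l. (v, l) \<in> P \<Longrightarrow> norm l \<le> C * fnorm S v"
    and C: "0 \<le> C"
  obtains g w where "g \<in> elems S" "fnorm S g \<le> C" "\<And>v l. (v, l) \<in> P \<Longrightarrow> form S v g = l"
    "\<And>n::nat. w n \<in> fst ` P" "(\<lambda>n. fnorm S (\<lambda>z. w n z - g z)) \<longlonglongrightarrow> 0"
proof -
  define \<Phi> where "\<Phi> p = (fnorm S (fst p))\<^sup>2 - 2 * Re (snd p)" for p :: "('a \<Rightarrow> 'v) \<times> complex"
  define I where "I = Inf (\<Phi> ` P)"
  have low: "- C\<^sup>2 \<le> \<Phi> p" if "p \<in> P" for p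
  proof -
    have "Re (snd p) \<le> C * fnorm S (fst p)"
      using bound[of "fst p" "snd p"] that complex_Re_le_cmod[of "snd p"] by simp
    moreover have "0 \<le> (fnorm S (fst p) - C)\<^sup>2" by simp
    ultimately show ?thesis by (simp add: \<Phi>_def power2_diff algebra_simps)
  qed
  then have bdd: "bdd_below (\<Phi> ` P)" by (meson bdd_belowI2)
  have I_le: "I \<le> \<Phi> p" if "p \<in> P" for p
    unfolding I_def using bdd that by (rule cINF_lower)
  have "\<exists>p\<in>P. \<Phi> p < I + 1 / real (Suc n)" for n
    using cInf_lessD[of "\<Phi> ` P" "I + 1 / real (Suc n)"] \<open>P \<noteq> {}\<close> unfolding I_def by auto
  then obtain p where p: "\<And>n. p n \<in> P" "\<And>n. \<Phi> (p n) < I + 1 / real (Suc n)"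
    by metis
  define v where "v n = fst (p n)" for n
  define l where "l n = snd (p n)" for n
  have vl: "(v n, l n) \<in> P" for n using p(1)[of n] by (simp add: v_def l_def)
  have v: "v n \<in> elems S" for n using vl by (rule P)
  have \<Phi>vl: "(fnorm S (v n))\<^sup>2 - 2 * Re (l n) < I + 1 / real (Suc n)" for n
    using p(2)[of n] by (simp add: \<Phi>_def v_def l_def)
  \<comment> \<open>By the parallelogram law a minimising sequence is Cauchy.\<close>
  have dist: "(fnorm S (\<lambda>z. v m z - v n z))\<^sup>2 < 2 / real (Suc m) + 2 / real (Suc n)" for m n
  proof -
    let ?q = "\<lambda>z. scl (1/2) (v m z + v n z)"
    have "I \<le> \<Phi> (?q, 1/2 * (l m + l n))"
      by (intro I_le scl add vl)
    then have "4 * I \<le> 4 * (fnorm S ?q)\<^sup>2 - 4 * Re (l m + l n)"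
      by (simp add: \<Phi>_def field_simps)
    moreover have "4 * (fnorm S ?q)\<^sup>2 + (fnorm S (\<lambda>z. v m z - v n z))\<^sup>2
        = 2 * (fnorm S (v m))\<^sup>2 + 2 * (fnorm S (v n))\<^sup>2"
      by (simp add: fnorm_power2 form_add form_add_right form_diff form_diff_right form_scl
          form_scl_right elems_add elems_diff elems_scl v) (simp add: field_simps)
    ultimately show ?thesis using \<Phi>vl[of m] \<Phi>vl[of n] by simp
  qed
  have "\<exists>g\<in>elems S. (\<lambda>n. fnorm S (\<lambda>z. v n z - g z)) \<longlonglongrightarrow> 0"
  proof (rule complete[OF v])
    fix \<epsilon> :: real assume \<epsilon>: "\<epsilon> > 0"
    obtain N where N: "4 / \<epsilon>\<^sup>2 < real N" using reals_Archimedean2 by blast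
    have "fnorm S (\<lambda>z. v m z - v n z) < \<epsilon>" if "N \<le> m" "N \<le> n" for m n
    proof -
      have s: "2 / real (Suc k) < \<epsilon>\<^sup>2 / 2" if "N \<le> k" for k
      proof -
        have "4 / \<epsilon>\<^sup>2 < real (Suc k)" using N that by linarith
        then show ?thesis using \<epsilon> by (simp add: field_simps)
      qed
      have "(fnorm S (\<lambda>z. v m z - v n z))\<^sup>2 < \<epsilon>\<^sup>2"
        using dist[of m n] s[of m] s[of n] that by linarith
      then show ?thesis
        using \<epsilon> by (intro power_less_imp_less_base[of _ 2 \<epsilon>]) auto
    qed
    then show "\<exists>N. \<forall>k\<ge>N. \<forall>l\<ge>N. fnorm S (\<lambda>z. v k z - v l z) < \<epsilon>" by blast
  qed
  then obtain g where g: "g \<in> elems S" and lim: "(\<lambda>n. fnorm S (\<lambda>z. v n z - g z)) \<longlonglongrightarrow> 0"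
    by blast
  have inv0: "(\<lambda>n. 1 / real (Suc n)) \<longlonglongrightarrow> 0"
    using LIMSEQ_inverse_real_of_nat by (simp add: inverse_eq_divide)
  \<comment> \<open>The first variation of the functional vanishes at the minimiser.\<close>
  have repr: "form S u g = k" if uk: "(u, k) \<in> P" for u k
  proof -
    have u: "u \<in> elems S" using uk by (rule P)
    define d where "d = form S u g - k"
    have var: "0 \<le> 2 * Re (t * d) + (norm t)\<^sup>2 * (fnorm S u)\<^sup>2" for t
    proof -
      have "0 \<le> 1 / real (Suc n) + (2 * Re (t * (form S u (v n) - k)) + (norm t)\<^sup>2 * (fnorm S u)\<^sup>2)" for n
      proof -
        let ?q = "\<lambda>z. v n z + scl t (u z)"
        have "I \<le> \<Phi> (?q, l n + t * k)"
          by (intro I_le scl add vl uk)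
        then have "I \<le> (fnorm S ?q)\<^sup>2 - 2 * Re (l n + t * k)"
          by (simp add: \<Phi>_def)
        moreover have "(fnorm S ?q)\<^sup>2 = Re (form S (v n) (v n)) + Re (t * form S u (v n))
            + Re (cnj t * form S (v n) u) + Re (t * cnj t * form S u u)"
          by (simp add: fnorm_power2 form_add form_add_right form_scl form_scl_right elems_add
              elems_scl v u algebra_simps)
        moreover have "cnj t * form S (v n) u = cnj (t * form S u (v n))"
          by (simp add: form_cnj v u)
        then have "Re (cnj t * form S (v n) u) = Re (t * form S u (v n))"
          by (simp only: complex_cnj(1) cnj.sel)
        moreover have "Re (t * cnj t * form S u u) = (norm t)\<^sup>2 * (fnorm S u)\<^sup>2"
          by (simp add: form_self u complex_norm_square[symmetric])
        moreover have "Re (form S (v n) (v n)) = (fnorm S (v n))\<^sup>2"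
          by (simp add: fnorm_power2 v)
        ultimately show ?thesis using \<Phi>vl[of n] by (simp add: algebra_simps)
      qed
      moreover have "(\<lambda>n. form S u (v n)) \<longlonglongrightarrow> form S u g"
        using tendsto_cnj[OF form_tendsto[OF v g u lim]] by (simp add: form_cnj v g u)
      then have "(\<lambda>n. 1 / real (Suc n) + (2 * Re (t * (form S u (v n) - k)) + (norm t)\<^sup>2 * (fnorm S u)\<^sup>2))
          \<longlonglongrightarrow> 0 + (2 * Re (t * d) + (norm t)\<^sup>2 * (fnorm S u)\<^sup>2)"
        unfolding d_def by (intro tendsto_intros inv0)
      ultimately show ?thesis
        by (metis (no_types, lifting) LIMSEQ_le_const add_0)
    qed
    \<comment> \<open>For \<open>t = - s cnj d\<close> with this \<open>s\<close> the quadratic term is at most half the size of the negative linear one.\<close>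
    define s where "s = 1 / (1 + (fnorm S u)\<^sup>2)"
    have s: "s > 0" "s * (1 + (fnorm S u)\<^sup>2) = 1"
      by (simp_all add: s_def add_pos_nonneg add_nonneg_eq_0_iff)
    have "0 \<le> 2 * Re (- s * cnj d * d) + (norm (- s * cnj d))\<^sup>2 * (fnorm S u)\<^sup>2"
      using var[of "- s * cnj d"] by simp
    also have "Re (- s * cnj d * d) = - s * (norm d)\<^sup>2"
      unfolding cmod_power2 by (simp add: power2_eq_square algebra_simps)
    also have "(norm (- s * cnj d))\<^sup>2 * (fnorm S u)\<^sup>2 = s * (norm d)\<^sup>2 * (s * (fnorm S u)\<^sup>2)"
      by (simp add: norm_mult power2_eq_square)
    also have "\<dots> \<le> s * (norm d)\<^sup>2 * 1"
      using s by (intro mult_left_mono) (auto simp: algebra_simps)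
    finally have "s * (norm d)\<^sup>2 \<le> 0" by simp
    then have "d = 0" using s by (simp add: mult_le_0_iff)
    then show ?thesis by (simp add: d_def)
  qed
  have "(\<lambda>n. fnorm S (v n) - fnorm S g) \<longlonglongrightarrow> 0"
  proof (rule Lim_null_comparison[OF _ lim], rule always_eventually, rule allI)
    fix n
    have "fnorm S (\<lambda>z. g z - v n z) = fnorm S (\<lambda>z. v n z - g z)"
      using power2_eq_iff_nonneg[of "fnorm S (\<lambda>z. g z - v n z)" "fnorm S (\<lambda>z. v n z - g z)"]
      by (simp add: fnorm_nonneg fnorm_power2 form_diff form_diff_right elems_diff v g)
    then show "norm (fnorm S (v n) - fnorm S g) \<le> fnorm S (\<lambda>z. v n z - g z)"
      using fnorm_triangle[OF v g, of n] fnorm_triangle[OF g v, of n] by simp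
  qed
  then have limn: "(\<lambda>n. fnorm S (v n)) \<longlonglongrightarrow> fnorm S g" by (rule LIM_zero_cancel)
  have "norm (form S g g) \<le> C * fnorm S g"
  proof (rule LIMSEQ_le)
    show "(\<lambda>n. norm (form S (v n) g)) \<longlonglongrightarrow> norm (form S g g)"
      by (intro tendsto_norm form_tendsto v g lim)
    show "(\<lambda>n. C * fnorm S (v n)) \<longlonglongrightarrow> C * fnorm S g"
      by (intro tendsto_intros limn)
    show "\<exists>N. \<forall>n\<ge>N. norm (form S (v n) g) \<le> C * fnorm S (v n)"
      using bound[OF vl] repr[OF vl] by simp
  qed
  then have "fnorm S g * fnorm S g \<le> C * fnorm S g"
    by (simp add: form_self g norm_power power2_eq_square norm_mult)
  then have "fnorm S g \<le> C"
    using fnorm_nonneg[OF g] C by (cases "fnorm S g = 0") auto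
  moreover have "v n \<in> fst ` P" for n using vl[of n] by force
  ultimately show thesis using that g repr lim by blast
qed

text \<open>
  The moment problem \<open>\<langle>u\<^sub>j, g\<rangle> = \<mu>\<^sub>j\<close> is solvable with \<open>\<parallel>g\<parallel> \<le> C\<close> as soon as it is bounded on finite
  combinations.  For kernel functions \<open>u\<^sub>j\<close> the equations prescribe the values of \<open>g\<close>, so this is a
  criterion for membership in a reproducing kernel space.
\<close>

corollary interpolation:
  fixes u :: "'j \<Rightarrow> 'a \<Rightarrow> 'v" and \<mu> :: "'j \<Rightarrow> complex"
  assumes u: "\<And>j. j \<in> J \<Longrightarrow> u j \<in> elems S"
    and bound: "\<And>X c. finite X \<Longrightarrow> X \<subseteq> J \<Longrightarrow>
      norm (\<Sum>j\<in>X. c j * \<mu> j) \<le> C * fnorm S (\<lambda>z. \<Sum>j\<in>X. scl (c j) (u j z))"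
    and C: "0 \<le> C"
  obtains g w where "g \<in> elems S" "fnorm S g \<le> C" "\<And>j. j \<in> J \<Longrightarrow> form S (u j) g = \<mu> j"
    "\<And>n::nat. \<exists>X c. finite X \<and> X \<subseteq> J \<and> w n = (\<lambda>z. \<Sum>j\<in>X. scl (c j) (u j z))"
    "(\<lambda>n. fnorm S (\<lambda>z. w n z - g z)) \<longlonglongrightarrow> 0"
proof -
  define comb where "comb X c = ((\<lambda>z. \<Sum>j\<in>X. scl (c j) (u j z)), \<Sum>j\<in>X. c j * \<mu> j)" for X c
  define P where "P = {p. \<exists>X c. finite X \<and> X \<subseteq> J \<and> p = comb X c}"
  have combP: "comb X c \<in> P" if "finite X" "X \<subseteq> J" for X c
    using that unfolding P_def by blast
  have pad: "comb X c = comb Z (\<lambda>j. if j \<in> X then c j else 0)" if "finite Z" "X \<subseteq> Z" for X Z c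
  proof -
    have "(\<Sum>j\<in>X. scl (c j) (u j z)) = (\<Sum>j\<in>Z. scl (if j \<in> X then c j else 0) (u j z))" for z
      using that by (intro sum.mono_neutral_cong_left) auto
    moreover have "(\<Sum>j\<in>X. c j * \<mu> j) = (\<Sum>j\<in>Z. (if j \<in> X then c j else 0) * \<mu> j)"
      using that by (intro sum.mono_neutral_cong_left) auto
    ultimately show ?thesis unfolding comb_def by simp
  qed
  obtain g w where gw: "g \<in> elems S" "fnorm S g \<le> C" "\<And>v l. (v, l) \<in> P \<Longrightarrow> form S v g = l"
    "\<And>n::nat. w n \<in> fst ` P" "(\<lambda>n. fnorm S (\<lambda>z. w n z - g z)) \<longlonglongrightarrow> 0"
  proof (rule riesz_pairs[of P C])
    show "v \<in> elems S" if "(v, l) \<in> P" for v l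
      using that u unfolding P_def comb_def by (auto intro!: elems_sum elems_scl)
    show "P \<noteq> {}" using combP[of "{}"] by blast
    show "norm l \<le> C * fnorm S v" if "(v, l) \<in> P" for v l
      using that bound unfolding P_def comb_def by auto
    show "((\<lambda>z. scl c (v z)), c * l) \<in> P" if "(v, l) \<in> P" for v l c
    proof -
      obtain X d where X: "finite X" "X \<subseteq> J" "(v, l) = comb X d"
        using \<open>(v, l) \<in> P\<close> unfolding P_def by blast
      have "((\<lambda>z. scl c (v z)), c * l) = comb X (\<lambda>j. c * d j)"
        using X(3) by (simp add: comb_def scale_sum_right sum_distrib_left mult.assoc)
      with combP[OF X(1,2)] show ?thesis by simp
    qed
    show "((\<lambda>z. v z + v' z), l + l') \<in> P" if vl: "(v, l) \<in> P" "(v', l') \<in> P" for v l v' l'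
    proof -
      obtain X c Y d where X: "finite X" "X \<subseteq> J" "(v, l) = comb X c"
        and Y: "finite Y" "Y \<subseteq> J" "(v', l') = comb Y d"
        using vl unfolding P_def by blast
      have "(v, l) = comb (X \<union> Y) (\<lambda>j. if j \<in> X then c j else 0)"
        "(v', l') = comb (X \<union> Y) (\<lambda>j. if j \<in> Y then d j else 0)"
        using X Y pad[of "X \<union> Y" X c] pad[of "X \<union> Y" Y d] by auto
      then have "((\<lambda>z. v z + v' z), l + l') = comb (X \<union> Y)
          (\<lambda>j. (if j \<in> X then c j else 0) + (if j \<in> Y then d j else 0))"
        unfolding comb_def prod.inject
        by (simp only: scale_left_distrib sum.distrib distrib_right)
      with combP[of "X \<union> Y"] X Y show ?thesis by simp
    qed
  qed (use C in auto)
  show thesis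
  proof (rule that[OF gw(1,2)])
    show "form S (u j) g = \<mu> j" if "j \<in> J" for j
      using gw(3)[of "u j" "\<mu> j"] combP[of "{j}" "\<lambda>_. 1"] that by (simp add: comb_def)
    show "\<exists>X c. finite X \<and> X \<subseteq> J \<and> w n = (\<lambda>z. \<Sum>j\<in>X. scl (c j) (u j z))" for n
    proof -
      obtain q where "q \<in> P" "w n = fst q" using gw(4)[of n] by blast
      then obtain X c where "finite X \<and> X \<subseteq> J \<and> w n = fst (comb X c)"
        unfolding P_def by blast
      then show ?thesis unfolding comb_def fst_conv by (intro exI)
    qed
  qed (rule gw(5))
qed

text \<open>
  The square of the norm of \<open>\<Sigma> a\<^sub>j \<and> b\<^sub>j\<close> in the exterior square, expressed without forming that space.
\<close>

definition wedge_gram :: "'j set \<Rightarrow> ('j \<Rightarrow> 'a \<Rightarrow> 'v) \<Rightarrow> ('j \<Rightarrow> 'a \<Rightarrow> 'v) \<Rightarrow> complex" where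
  "wedge_gram X a b = (\<Sum>j\<in>X. \<Sum>k\<in>X.
     form S (a j) (a k) * form S (b j) (b k) - form S (a j) (b k) * form S (b j) (a k))"

definition perp :: "('a \<Rightarrow> 'v) \<Rightarrow> ('a \<Rightarrow> 'v) \<Rightarrow> 'a \<Rightarrow> 'v" where
  "perp u f = (\<lambda>z. f z - scl (form S f u / form S u u) (u z))"

lemma elems_perp: "u \<in> elems S \<Longrightarrow> f \<in> elems S \<Longrightarrow> perp u f \<in> elems S"
  unfolding perp_def by (intro elems_diff elems_scl)

lemma form_perp_perp:
  assumes "u \<in> elems S" "f \<in> elems S" "g \<in> elems S" and nz: "form S u u \<noteq> 0"
  shows "form S (perp u f) (perp u g) = form S f g - form S f u * cnj (form S g u) / form S u u"
proof -
  have "cnj (form S u u) = form S u u" "form S u g = cnj (form S g u)"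
    using assms by (simp_all add: form_cnj)
  then show ?thesis
    using assms unfolding perp_def
    by (simp add: form_diff form_diff_right form_scl form_scl_right elems_diff elems_scl)
qed

text \<open>
  Splitting every vector into its component along \<open>u\<close> and the rest splits \<open>\<Sigma> a\<^sub>j \<and> b\<^sub>j\<close> into the orthogonal
  sum of a wedge in the complement of \<open>u\<close> and of \<open>u \<and> p\<close> divided by \<open>\<parallel>u\<parallel>\<^sup>2\<close>; the terms \<open>u \<and> u\<close> cancel.
\<close>

lemma wedge_gram_perp:
  assumes u: "u \<in> elems S" and nz: "form S u u \<noteq> 0"
    and ab: "\<And>j. j \<in> X \<Longrightarrow> a j \<in> elems S" "\<And>j. j \<in> X \<Longrightarrow> b j \<in> elems S"
  defines "p \<equiv> \<lambda>z. \<Sum>j\<in>X. scl (form S (a j) u) (perp u (b j) z) - scl (form S (b j) u) (perp u (a j) z)"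
  shows "wedge_gram X a b =
    wedge_gram X (\<lambda>j. perp u (a j)) (\<lambda>j. perp u (b j)) + form S p p / form S u u"
proof -
  define q where "q j = (\<lambda>z. scl (form S (a j) u) (perp u (b j) z) - scl (form S (b j) u) (perp u (a j) z))" for j
  have pab: "perp u (a j) \<in> elems S" "perp u (b j) \<in> elems S" if "j \<in> X" for j
    using that u ab by (simp_all add: elems_perp)
  have q: "q j \<in> elems S" if "j \<in> X" for j
    unfolding q_def using pab[OF that] by (intro elems_diff elems_scl)
  have "form S p p = (\<Sum>j\<in>X. \<Sum>k\<in>X. form S (q j) (q k))"
  proof -
    have "p = (\<lambda>z. \<Sum>j\<in>X. q j z)" by (simp add: p_def q_def)
    then show ?thesis by (simp add: form_sum form_sum_right elems_sum q)
  qed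
  moreover have "form S (a j) (a k) * form S (b j) (b k) - form S (a j) (b k) * form S (b j) (a k)
     = form S (perp u (a j)) (perp u (a k)) * form S (perp u (b j)) (perp u (b k))
       - form S (perp u (a j)) (perp u (b k)) * form S (perp u (b j)) (perp u (a k))
       + form S (q j) (q k) / form S u u" if "j \<in> X" "k \<in> X" for j k
  proof -
    let ?i = "1 / form S u u"
    have e: "form S f g = form S (perp u f) (perp u g) + form S f u * cnj (form S g u) * ?i"
      if "f \<in> elems S" "g \<in> elems S" for f g
      using form_perp_perp[OF u that nz] by simp
    have qq: "form S (q j) (q k) =
        form S (a j) u * cnj (form S (a k) u) * form S (perp u (b j)) (perp u (b k))
        - form S (a j) u * cnj (form S (b k) u) * form S (perp u (b j)) (perp u (a k))
        - form S (b j) u * cnj (form S (a k) u) * form S (perp u (a j)) (perp u (b k))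
        + form S (b j) u * cnj (form S (b k) u) * form S (perp u (a j)) (perp u (a k))"
      unfolding q_def using pab[OF that(1)] pab[OF that(2)]
      by (simp add: form_diff form_diff_right form_scl form_scl_right elems_diff elems_scl algebra_simps)
    show ?thesis
      unfolding qq e[OF ab(1)[OF that(1)] ab(1)[OF that(2)]] e[OF ab(1)[OF that(1)] ab(2)[OF that(2)]]
        e[OF ab(2)[OF that(1)] ab(1)[OF that(2)]] e[OF ab(2)[OF that(1)] ab(2)[OF that(2)]]
      by (simp add: divide_inverse algebra_simps)
  qed
  ultimately show ?thesis
    unfolding wedge_gram_def
    by (simp add: sum.distrib sum_divide_distrib cong: sum.cong)
qed

text \<open>
  Choosing \<open>u = a\<^sub>i\<close> in the splitting kills \<open>a\<^sub>i\<close> and keeps the vanishing \<open>a\<^sub>j\<close> zero, so induction on the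
  number of nonzero \<open>a\<^sub>j\<close> exhibits the expression as a sum of squared norms.
\<close>

lemma wedge_gram_nonneg:
  assumes "finite X" "\<And>j. j \<in> X \<Longrightarrow> a j \<in> elems S" "\<And>j. j \<in> X \<Longrightarrow> b j \<in> elems S"
  shows "wedge_gram X a b \<in> \<real>\<^sub>\<ge>\<^sub>0"
  using assms(2,3)
proof (induction "card {j \<in> X. a j \<noteq> (\<lambda>z. 0)}" arbitrary: a b rule: less_induct)
  case less
  show ?case
  proof (cases "\<exists>i\<in>X. a i \<noteq> (\<lambda>z. 0)")
    case False
    then have "wedge_gram X a b = 0"
      unfolding wedge_gram_def using less.prems
      by (intro sum.neutral ballI) (simp add: form_zero)
    then show ?thesis by simp
  next
    case True
    then obtain i where i: "i \<in> X" "a i \<noteq> (\<lambda>z. 0)" by blast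
    define u where "u = a i"
    have u: "u \<in> elems S" using i less.prems by (simp add: u_def)
    have nz: "form S u u \<noteq> 0" using form_self_eq_0[OF u] i by (auto simp: u_def)
    have "perp u (a i) = (\<lambda>z. 0)" using nz by (simp add: perp_def u_def)
    moreover have "perp u (a j) = (\<lambda>z. 0)" if "a j = (\<lambda>z. 0)" for j
      using that u by (simp add: perp_def form_zero)
    ultimately have "{j \<in> X. perp u (a j) \<noteq> (\<lambda>z. 0)} \<subset> {j \<in> X. a j \<noteq> (\<lambda>z. 0)}"
      using i by blast
    then have "card {j \<in> X. perp u (a j) \<noteq> (\<lambda>z. 0)} < card {j \<in> X. a j \<noteq> (\<lambda>z. 0)}"
      using assms(1) by (intro psubset_card_mono) auto
    then have "wedge_gram X (\<lambda>j. perp u (a j)) (\<lambda>j. perp u (b j)) \<in> \<real>\<^sub>\<ge>\<^sub>0"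
      by (rule less.hyps) (use less.prems u in \<open>simp_all add: elems_perp\<close>)
    then show ?thesis
      unfolding wedge_gram_perp[of u X a b, OF u nz less.prems, simplified]
      using u less.prems
      by (intro nonneg_Reals_add_I nonneg_Reals_divide_I form_self_nonneg elems_sum elems_diff
          elems_scl elems_perp) auto
  qed
qed

text \<open>
  With \<open>u = e\<close> the vector \<open>p\<close> of the splitting is the sum of the \<open>b\<^sub>j\<close>, and the remaining wedge
  contributes a nonnegative amount.
\<close>

lemma norm_sum_le_wedge_gram:
  assumes X: "finite X" and e: "e \<in> elems S" "e \<noteq> (\<lambda>z. 0)"
    and ab: "\<And>j. j \<in> X \<Longrightarrow> a j \<in> elems S" "\<And>j. j \<in> X \<Longrightarrow> b j \<in> elems S"
    and abe: "\<And>j. j \<in> X \<Longrightarrow> form S (a j) e = 1" "\<And>j. j \<in> X \<Longrightarrow> form S (b j) e = 0"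
  shows "(fnorm S (\<lambda>z. \<Sum>j\<in>X. b j z))\<^sup>2 \<le> (fnorm S e)\<^sup>2 * Re (wedge_gram X a b)"
proof -
  let ?B = "\<lambda>z. \<Sum>j\<in>X. b j z"
  have nz: "form S e e \<noteq> 0" using form_self_eq_0[OF e(1)] e(2) by blast
  have B: "?B \<in> elems S" using ab by (intro elems_sum)
  have "(\<lambda>z. \<Sum>j\<in>X. scl (form S (a j) e) (perp e (b j) z) - scl (form S (b j) e) (perp e (a j) z)) = ?B"
    by (simp add: abe perp_def)
  then have "wedge_gram X a b = wedge_gram X (\<lambda>j. perp e (a j)) (\<lambda>j. perp e (b j)) + form S ?B ?B / form S e e"
    using wedge_gram_perp[of e X a b, OF e(1) nz ab] by simp
  also have "form S ?B ?B / form S e e = of_real ((fnorm S ?B)\<^sup>2 / (fnorm S e)\<^sup>2)"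
    by (simp add: form_self B e)
  finally have "(fnorm S ?B)\<^sup>2 / (fnorm S e)\<^sup>2 \<le> Re (wedge_gram X a b)"
    using wedge_gram_nonneg[of X "\<lambda>j. perp e (a j)" "\<lambda>j. perp e (b j)"] X ab e
    by (simp add: elems_perp complex_nonneg_Reals_iff)
  moreover have "(fnorm S e)\<^sup>2 > 0"
    using nz by (simp add: form_self e)
  ultimately show ?thesis by (simp add: divide_le_eq mult.commute)
qed

end

section \<open>Complex lines in several variables\<close>

lemma module_complex_mult: "module ((*) :: complex \<Rightarrow> complex \<Rightarrow> complex)"
  by unfold_locales (simp_all add: algebra_simps)

lemma module_vector_scalar_mult: "module ((*s) :: complex \<Rightarrow> complex ^ 'n \<Rightarrow> complex ^ 'n)"
  by unfold_locales (simp_all add: vec_eq_iff algebra_simps)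

lemma norm_axis_eq: "norm (axis i t :: complex ^ 'm) = norm t"
  by (simp add: norm_vec_def L2_set_def axis_def if_distrib[of "\<lambda>x. (norm x)\<^sup>2"] cong: if_cong)

lemma dist_add_axis: "dist z (z + axis i t) = norm (t :: complex)"
  by (simp add: dist_norm norm_axis_eq)

lemma open_contains_slice_disc:
  fixes \<Omega> :: "(complex ^ 'm) set"
  assumes "open \<Omega>" "z \<in> \<Omega>"
  obtains \<rho> where "\<rho> > 0" "\<And>t. norm t < \<rho> \<Longrightarrow> z + axis i t \<in> \<Omega>"
proof -
  obtain \<rho> where \<rho>: "\<rho> > 0" "ball z \<rho> \<subseteq> \<Omega>"
    using assms unfolding open_contains_ball by blast
  have "z + axis i t \<in> \<Omega>" if "norm t < \<rho>" for t
    by (rule subsetD[OF \<rho>(2)]) (use that in \<open>simp only: mem_ball dist_add_axis\<close>)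
  with \<rho>(1) that show thesis by blast
qed

lemma axis_has_derivative: "((\<lambda>t::complex. z + axis i t) has_derivative axis i) (at t)"
proof -
  have "bounded_linear (axis i :: complex \<Rightarrow> complex ^ 'a)"
  proof (rule bounded_linear_intro[where K = 1])
    show "axis i (x + y) = axis i x + (axis i y :: complex ^ 'a)" for x y
      by (simp add: axis_def vec_eq_iff)
    show "axis i (r *\<^sub>R x) = r *\<^sub>R (axis i x :: complex ^ 'a)" for r x
      by (simp add: axis_def vec_eq_iff)
  qed (simp add: norm_axis_eq)
  then show ?thesis
    using has_derivative_add[OF has_derivative_const bounded_linear_imp_has_derivative] by fastforce
qed

lemma cvec_holomorphic_on_slice:
  fixes g :: "complex ^ 'm \<Rightarrow> complex"
  assumes g: "cvec_holomorphic_on g \<Omega>" and "open \<Omega>" and A: "\<And>t. t \<in> A \<Longrightarrow> z + axis i t \<in> \<Omega>"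
  shows "(\<lambda>t. g (z + axis i t)) holomorphic_on A"
  unfolding holomorphic_on_def field_differentiable_def
proof
  fix t assume t: "t \<in> A"
  obtain D where D: "(g has_derivative D) (at (z + axis i t) within \<Omega>)"
      and lin: "\<And>c v. D (c *s v) = c * D v"
    using g A[OF t] unfolding cvec_holomorphic_on_def by blast
  have "(g has_derivative D) (at (z + axis i t))"
    using D A[OF t] \<open>open \<Omega>\<close> at_within_open by metis
  from has_derivative_compose[OF axis_has_derivative this]
  have "((\<lambda>t. g (z + axis i t)) has_derivative (\<lambda>h. D (axis i h))) (at t)" .
  moreover have "D (axis i h) = D (axis i 1) * h" for h
  proof -
    have "axis i h = h *s axis i 1"
      by (simp add: axis_def vec_eq_iff)
    then show ?thesis using lin[of h "axis i 1"] by simp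
  qed
  then have "(\<lambda>h. D (axis i h)) = (*) (D (axis i 1))"
    by (intro ext)
  ultimately have "((\<lambda>t. g (z + axis i t)) has_field_derivative D (axis i 1)) (at t)"
    by (simp add: has_field_derivative_def)
  then show "\<exists>f'. ((\<lambda>t. g (z + axis i t)) has_field_derivative f') (at t within A)"
    using has_field_derivative_at_within by blast
qed

lemma partial_deriv_cong:
  fixes \<Omega> :: "(complex ^ 'm) set"
  assumes "open \<Omega>" "z \<in> \<Omega>" and eq: "\<And>x. x \<in> \<Omega> \<Longrightarrow> f x = g x"
  shows "partial_deriv i f z = partial_deriv i g z"
proof -
  obtain \<rho> where \<rho>: "\<rho> > 0" "\<And>t. norm t < \<rho> \<Longrightarrow> z + axis i t \<in> \<Omega>"
    using open_contains_slice_disc[OF assms(1,2)] by metis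
  have "\<forall>\<^sub>F t in nhds 0. t \<in> ball (0::complex) \<rho>"
    using \<rho>(1) by (intro eventually_nhds_in_open) auto
  then have "\<forall>\<^sub>F t in nhds 0. f (z + axis i t) = g (z + axis i t)"
    by eventually_elim (simp add: \<rho>(2) eq)
  then show ?thesis
    unfolding partial_deriv_def by (rule deriv_cong_ev) simp
qed

section \<open>Partial derivatives in the kernel space\<close>

locale sesqui_analytic_rkhs =
  fixes \<Omega> :: "(complex ^ 'm) set" and K :: "complex ^ 'm \<Rightarrow> complex ^ 'm \<Rightarrow> complex"
    and H :: "(complex ^ 'm, complex) function_space"
  assumes open_dom: "open \<Omega>" and sesqui: "sesqui_analytic \<Omega> K" and rkhs: "is_rkhs \<Omega> K H"
begin

sublocale hilbert_functions "(*)" \<Omega> H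
  using module_complex_mult rkhs
  by (simp add: hilbert_functions_def hilbert_functions_axioms_def is_rkhs_def)

definition ker :: "complex ^ 'm \<Rightarrow> complex ^ 'm \<Rightarrow> complex" where
  "ker x = zero_ext \<Omega> (\<lambda>z. K z x)"

lemma elems_ker: "x \<in> \<Omega> \<Longrightarrow> ker x \<in> elems H"
  and form_ker: "x \<in> \<Omega> \<Longrightarrow> f \<in> elems H \<Longrightarrow> form H f (ker x) = f x"
proof -
  assume "x \<in> \<Omega>"
  then have "zero_ext \<Omega> (\<lambda>z. K z x * 1) \<in> elems H \<and>
      (\<forall>f\<in>elems H. form H f (zero_ext \<Omega> (\<lambda>z. K z x * 1)) = f x * cnj 1)"
    using rkhs unfolding is_rkhs_def by blast
  then show "ker x \<in> elems H" "f \<in> elems H \<Longrightarrow> form H f (ker x) = f x"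
    by (simp_all add: ker_def)
qed

lemma ker_apply: "x \<in> \<Omega> \<Longrightarrow> ker y x = K x y"
  by (simp add: ker_def zero_ext_def)

lemma cnj_ker: "x \<in> \<Omega> \<Longrightarrow> y \<in> \<Omega> \<Longrightarrow> cnj (ker y x) = ker x y"
  using form_cnj[OF elems_ker elems_ker, of y x] by (simp add: form_ker elems_ker)

lemma norm_le_ker: "f \<in> elems H \<Longrightarrow> x \<in> \<Omega> \<Longrightarrow> norm (f x) \<le> fnorm H f * fnorm H (ker x)"
  using Cauchy_Schwarz_form[OF _ elems_ker, of f x] by (simp add: form_ker)

text \<open>
  The squared norm of the kernel function at \<open>x\<close> is \<open>K x x\<close>.  Conjugating the second variable turns
  the restriction of \<open>K\<close> to a complex line into a separately holomorphic function of two variables,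
  whose local boundedness is then evaluated at points \<open>(w, cnj w)\<close>.
\<close>

lemma ker_bounded_on_slice:
  assumes z: "z \<in> \<Omega>"
  obtains \<delta> B where "\<delta> > 0" "0 \<le> B"
    "\<And>t. norm t < \<delta> \<Longrightarrow> z + axis i t \<in> \<Omega> \<and> fnorm H (ker (z + axis i t)) \<le> B"
proof -
  obtain \<rho> where \<rho>: "\<rho> > 0" "\<And>t. norm t < \<rho> \<Longrightarrow> z + axis i t \<in> \<Omega>"
    using open_contains_slice_disc[OF open_dom z] by metis
  \<comment> \<open>The boundedness theorem is normalised to discs of radius 3.\<close>
  define r where "r = \<rho> / 3"
  have r: "r > 0" using \<rho>(1) by (simp add: r_def)
  define p where "p w = z + axis i (of_real r * w)" for w
  have p: "p w \<in> \<Omega>" if "norm w < 3" for w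
    unfolding p_def using that \<rho>(1) by (intro \<rho>(2)) (simp add: r_def norm_mult)
  have slice: "(\<lambda>w. g (p w)) holomorphic_on ball 0 3" if "cvec_holomorphic_on g \<Omega>" for g
  proof -
    have "(\<lambda>t. g (z + axis i t)) holomorphic_on ball 0 \<rho>"
      by (rule cvec_holomorphic_on_slice[OF that open_dom]) (simp add: \<rho>(2))
    moreover have "(\<lambda>w. complex_of_real r * w) ` ball 0 3 \<subseteq> ball 0 \<rho>"
      using \<rho>(1) by (auto simp: r_def dist_norm norm_mult)
    ultimately have "((\<lambda>t. g (z + axis i t)) \<circ> (\<lambda>w. of_real r * w)) holomorphic_on ball 0 3"
      by (intro holomorphic_on_compose_gen) (auto intro!: holomorphic_intros)
    then show ?thesis by (simp add: o_def p_def)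
  qed
  have "\<exists>B. \<forall>w\<in>cball 0 (1/2). \<forall>t\<in>ball 0 (1/8). norm (K (p w) (p (cnj t))) \<le> B"
  proof (rule separately_holomorphic_locally_bounded)
    show "(\<lambda>w. K (p w) (p (cnj t))) holomorphic_on ball 0 3" if "t \<in> ball 0 3" for t
      using sesqui p[of "cnj t"] that unfolding sesqui_analytic_def by (intro slice) auto
    show "(\<lambda>t. K (p w) (p (cnj t))) holomorphic_on ball 0 3" if "w \<in> ball 0 3" for w
    proof -
      have "(\<lambda>s. cnj (K (p w) (p s))) holomorphic_on ball 0 3"
        using sesqui p[of w] that unfolding sesqui_analytic_def by (intro slice) auto
      then have "(\<lambda>s. cnj (K (p w) (p s))) holomorphic_on cnj ` ball 0 3"
        by (rule holomorphic_on_subset) auto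
      from holomorphic_on_compose_cnj_cnj[OF this] show ?thesis
        by (simp add: o_def)
    qed
  qed
  then obtain B where B0: "\<forall>w\<in>cball 0 (1/2). \<forall>t\<in>ball 0 (1/8). norm (K (p w) (p (cnj t))) \<le> B"
    by blast
  have B: "norm (K (p w) (p (cnj t))) \<le> B" if "norm w \<le> 1/2" "norm t < 1/8" for w t
    using B0 that by simp
  show thesis
  proof
    show "0 < r / 8" using r by simp
    show "0 \<le> sqrt (max B 0)" by simp
    fix t :: complex assume t: "norm t < r / 8"
    define w where "w = t / of_real r"
    have w: "norm w < 1/8" "z + axis i t = p w"
      using t r by (simp_all add: w_def p_def norm_divide field_simps)
    have pw: "p w \<in> \<Omega>" using w by (intro p) simp
    have "(fnorm H (ker (p w)))\<^sup>2 = Re (K (p w) (p w))"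
      by (simp add: fnorm_power2 elems_ker pw form_ker ker_apply)
    also have "\<dots> \<le> B"
      using B[of w "cnj w"] w(1) complex_Re_le_cmod[of "K (p w) (p w)"] by simp
    finally have "fnorm H (ker (p w)) \<le> sqrt (max B 0)"
      by (intro real_le_rsqrt) simp
    with pw w(2) show "z + axis i t \<in> \<Omega> \<and> fnorm H (ker (z + axis i t)) \<le> sqrt (max B 0)"
      by simp
  qed
qed

text \<open>
  The Riesz vector of the functional \<open>v \<mapsto> \<langle>v, f\<rangle>\<close> on the span of the kernel functions lies in the closure of the span and
  takes the same values as \<open>f\<close>.
\<close>

lemma ker_span_dense:
  assumes f: "f \<in> elems H"
  obtains w where "\<And>n::nat. \<exists>X c. finite X \<and> X \<subseteq> \<Omega> \<and> w n = (\<lambda>z. \<Sum>x\<in>X. c x * ker x z)"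
    "(\<lambda>n. fnorm H (\<lambda>z. w n z - f z)) \<longlonglongrightarrow> 0"
proof (rule interpolation[of \<Omega> ker "\<lambda>x. cnj (f x)" "fnorm H f"])
  show "ker x \<in> elems H" if "x \<in> \<Omega>" for x
    using that by (rule elems_ker)
  show "norm (\<Sum>x\<in>X. c x * cnj (f x)) \<le> fnorm H f * fnorm H (\<lambda>z. \<Sum>x\<in>X. c x * ker x z)"
    if "finite X" "X \<subseteq> \<Omega>" for X c
  proof -
    have k: "ker x \<in> elems H" "(\<lambda>z. c x * ker x z) \<in> elems H" if "x \<in> X" for x
      using \<open>X \<subseteq> \<Omega>\<close> that by (auto intro: elems_ker elems_scl)
    have "form H (\<lambda>z. \<Sum>x\<in>X. c x * ker x z) f = (\<Sum>x\<in>X. form H (\<lambda>z. c x * ker x z) f)"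
      by (rule form_sum[OF k(2) f])
    also have "\<dots> = (\<Sum>x\<in>X. c x * cnj (f x))"
    proof (rule sum.cong[OF refl])
      fix x assume x: "x \<in> X"
      then have "x \<in> \<Omega>" using \<open>X \<subseteq> \<Omega>\<close> by blast
      then show "form H (\<lambda>z. c x * ker x z) f = c x * cnj (f x)"
        using form_cnj[OF f k(1)[OF x]] by (simp add: form_scl k x f form_ker)
    qed
    finally show ?thesis
      using Cauchy_Schwarz_form[OF elems_sum[of X "\<lambda>x z. c x * ker x z", OF k(2)] f]
      by (simp add: mult.commute)
  qed
  show "0 \<le> fnorm H f" using f by (rule fnorm_nonneg)
  fix g w
  assume g: "g \<in> elems H" "\<And>x. x \<in> \<Omega> \<Longrightarrow> form H (ker x) g = cnj (f x)"
    and w: "\<And>n::nat. \<exists>X c. finite X \<and> X \<subseteq> \<Omega> \<and> w n = (\<lambda>z. \<Sum>x\<in>X. c x * ker x z)"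
    and lim: "(\<lambda>n. fnorm H (\<lambda>z. w n z - g z)) \<longlonglongrightarrow> 0"
  have "g = f"
  proof
    fix x
    show "g x = f x"
    proof (cases "x \<in> \<Omega>")
      case True
      have "cnj (form H (ker x) g) = g x"
        using True g(1) by (simp add: form_cnj elems_ker form_ker)
      then show ?thesis using g(2)[OF True] by simp
    qed (simp add: elems_outside[OF f] elems_outside[OF g(1)])
  qed
  with lim have "(\<lambda>n. fnorm H (\<lambda>z. w n z - f z)) \<longlonglongrightarrow> 0" by simp
  with w show thesis by (rule that)
qed

text \<open>
  Norm convergence implies pointwise convergence, bounded where the kernel functions are bounded in
  norm.  So holomorphy passes from the kernel functions to all elements of the space.
\<close>

lemma slice_holomorphic:
  assumes z: "z \<in> \<Omega>"
  obtains \<delta> B where "\<delta> > 0" "0 \<le> B"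
    "\<And>f. f \<in> elems H \<Longrightarrow> (\<lambda>t. f (z + axis i t)) holomorphic_on ball 0 \<delta>"
    "\<And>f t. f \<in> elems H \<Longrightarrow> norm t < \<delta> \<Longrightarrow> norm (f (z + axis i t)) \<le> fnorm H f * B"
proof -
  obtain \<delta> B where \<delta>: "\<delta> > 0" "0 \<le> B"
    and B: "\<And>t. norm t < \<delta> \<Longrightarrow> z + axis i t \<in> \<Omega> \<and> fnorm H (ker (z + axis i t)) \<le> B"
    by (rule ker_bounded_on_slice[OF z, where i = i]) (rule that)
  have bd: "norm (f (z + axis i t)) \<le> fnorm H f * B" if f: "f \<in> elems H" and t: "norm t < \<delta>" for f t
  proof -
    have "norm (f (z + axis i t)) \<le> fnorm H f * fnorm H (ker (z + axis i t))"
      using B[OF t] by (intro norm_le_ker f) blast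
    also have "\<dots> \<le> fnorm H f * B"
      using B[OF t] by (intro mult_left_mono fnorm_nonneg f) blast
    finally show ?thesis .
  qed
  have hol: "(\<lambda>t. f (z + axis i t)) holomorphic_on ball 0 \<delta>" if f: "f \<in> elems H" for f
  proof -
    obtain w where w: "\<And>n::nat. \<exists>X c. finite X \<and> X \<subseteq> \<Omega> \<and> w n = (\<lambda>z. \<Sum>x\<in>X. c x * ker x z)"
      and lim: "(\<lambda>n. fnorm H (\<lambda>z. w n z - f z)) \<longlonglongrightarrow> 0"
      by (rule ker_span_dense[OF f]) (rule that)
    have wH: "w n \<in> elems H" for n
      using w[of n] by (auto intro!: elems_sum elems_scl elems_ker)
    obtain C where C: "\<And>n. fnorm H (\<lambda>z. w n z - f z) \<le> C"
      using convergent_imp_Bseq[OF convergentI[OF lim]] unfolding Bseq_def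
      by (metis abs_le_iff real_norm_def)
    show ?thesis
    proof (rule holomorphic_on_bounded_pointwise_limit)
      show "(\<lambda>t. w n (z + axis i t)) holomorphic_on ball 0 \<delta>" for n
      proof -
        obtain X c where X: "X \<subseteq> \<Omega>" "w n = (\<lambda>z. \<Sum>x\<in>X. c x * ker x z)"
          using w[of n] by blast
        have "(\<lambda>t. \<Sum>x\<in>X. c x * K (z + axis i t) x) holomorphic_on ball 0 \<delta>"
        proof (intro holomorphic_intros)
          fix x assume "x \<in> X"
          then have "cvec_holomorphic_on (\<lambda>z. K z x) \<Omega>"
            using X(1) sesqui unfolding sesqui_analytic_def by blast
          then show "(\<lambda>t. K (z + axis i t) x) holomorphic_on ball 0 \<delta>"
            by (rule cvec_holomorphic_on_slice[OF _ open_dom]) (use B in simp)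
        qed
        moreover have "w n (z + axis i t) = (\<Sum>x\<in>X. c x * K (z + axis i t) x)" if "t \<in> ball 0 \<delta>" for t
          using B[of t] that by (simp add: X(2) ker_apply)
        ultimately show ?thesis
          by (subst holomorphic_cong[OF refl]) auto
      qed
      show "norm (w n (z + axis i t)) \<le> (C + fnorm H f) * B" if t: "t \<in> ball 0 \<delta>" for n t
      proof -
        have "norm (w n (z + axis i t)) \<le> fnorm H (w n) * B"
          using t by (intro bd wH) simp
        also have "\<dots> \<le> (C + fnorm H f) * B"
          using fnorm_triangle[OF wH f, of n] C[of n] \<delta>(2) by (intro mult_right_mono) auto
        finally show ?thesis .
      qed
      show "(\<lambda>n. w n (z + axis i t)) \<longlonglongrightarrow> f (z + axis i t)" if "t \<in> ball 0 \<delta>" for t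
        using form_tendsto[OF wH f elems_ker lim, of "z + axis i t"] B[of t] that
        by (simp add: form_ker wH f)
    qed simp
  qed
  show thesis by (rule that[OF \<delta> hol bd])
qed

lemma partial_deriv_DERIV:
  assumes z: "z \<in> \<Omega>" and f: "f \<in> elems H"
  shows "((\<lambda>t. f (z + axis i t)) has_field_derivative partial_deriv i f z) (at 0)"
proof -
  obtain \<delta> where "\<delta> > 0" "(\<lambda>t. f (z + axis i t)) holomorphic_on ball 0 \<delta>"
    by (rule slice_holomorphic[OF z, where i = i]) (use f that in blast)
  then show ?thesis
    unfolding partial_deriv_def by (intro holomorphic_derivI[of _ "ball 0 \<delta>"]) auto
qed

lemma partial_deriv_add:
  assumes "z \<in> \<Omega>" "f \<in> elems H" "g \<in> elems H"
  shows "partial_deriv i (\<lambda>z. f z + g z) z = partial_deriv i f z + partial_deriv i g z"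
  unfolding partial_deriv_def[of i "\<lambda>z. f z + g z"]
  by (intro DERIV_imp_deriv DERIV_add partial_deriv_DERIV assms)

lemma partial_deriv_mult_const:
  assumes "z \<in> \<Omega>" "f \<in> elems H"
  shows "partial_deriv i (\<lambda>z. c * f z) z = c * partial_deriv i f z"
  unfolding partial_deriv_def[of i "\<lambda>z. c * f z"]
  by (intro DERIV_imp_deriv DERIV_cmult partial_deriv_DERIV assms)

text \<open>
  Cauchy's estimate bounds the derivative at \<open>z\<close> by the supremum over a small disc, and that supremum
  by a multiple of the norm.
\<close>

lemma partial_deriv_representable:
  assumes z: "z \<in> \<Omega>"
  shows "\<exists>b\<in>elems H. \<forall>f\<in>elems H. form H f b = partial_deriv i f z"
proof -
  obtain \<delta> B where \<delta>: "\<delta> > 0" "0 \<le> B"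
    and hol: "\<And>f. f \<in> elems H \<Longrightarrow> (\<lambda>t. f (z + axis i t)) holomorphic_on ball 0 \<delta>"
    and bd: "\<And>f t. f \<in> elems H \<Longrightarrow> norm t < \<delta> \<Longrightarrow> norm (f (z + axis i t)) \<le> fnorm H f * B"
    by (rule slice_holomorphic[OF z, where i = i]) (rule that)
  have bound: "norm (partial_deriv i f z) \<le> B / (\<delta> / 2) * fnorm H f" if f: "f \<in> elems H" for f
  proof -
    have sub: "cball 0 (\<delta> / 2) \<subseteq> ball (0::complex) \<delta>" using \<delta> by auto
    have "norm ((deriv ^^ 1) (\<lambda>t. f (z + axis i t)) 0) \<le> fact 1 * (fnorm H f * B) / (\<delta> / 2) ^ 1"
    proof (rule Cauchy_inequality)
      show "(\<lambda>t. f (z + axis i t)) holomorphic_on ball 0 (\<delta> / 2)"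
        by (rule holomorphic_on_subset[OF hol[OF f]]) (use sub in auto)
      show "continuous_on (cball 0 (\<delta> / 2)) (\<lambda>t. f (z + axis i t))"
        by (rule holomorphic_on_imp_continuous_on[OF holomorphic_on_subset[OF hol[OF f] sub]])
      show "norm (f (z + axis i t)) \<le> fnorm H f * B" if "norm (0 - t) = \<delta> / 2" for t
        using that \<delta> by (intro bd f) simp
    qed (use \<delta> in simp)
    then show ?thesis by (simp add: partial_deriv_def mult_ac)
  qed
  obtain b where "b \<in> elems H"
      "\<And>f l. (f, l) \<in> {(f, l). f \<in> elems H \<and> l = partial_deriv i f z} \<Longrightarrow> form H f b = l"
  proof (rule riesz_pairs[of "{(f, l). f \<in> elems H \<and> l = partial_deriv i f z}" "B / (\<delta> / 2)"])
    show "{(f, l). f \<in> elems H \<and> l = partial_deriv i f z} \<noteq> {}"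
      using elems_zero by blast
    show "0 \<le> B / (\<delta> / 2)" using \<delta> by simp
    show "v \<in> elems H" "norm l \<le> B / (\<delta> / 2) * fnorm H v"
      if "(v, l) \<in> {(f, l). f \<in> elems H \<and> l = partial_deriv i f z}" for v l
      using that bound[of v] by auto
    show "((\<lambda>z. c * v z), c * l) \<in> {(f, l). f \<in> elems H \<and> l = partial_deriv i f z}"
      if "(v, l) \<in> {(f, l). f \<in> elems H \<and> l = partial_deriv i f z}" for v l c
      using that z by (simp add: elems_scl partial_deriv_mult_const)
    show "((\<lambda>z. v z + v' z), l + l') \<in> {(f, l). f \<in> elems H \<and> l = partial_deriv i f z}"
      if "(v, l) \<in> {(f, l). f \<in> elems H \<and> l = partial_deriv i f z}"
        "(v', l') \<in> {(f, l). f \<in> elems H \<and> l = partial_deriv i f z}" for v l v' l'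
      using that z by (simp add: elems_add partial_deriv_add)
  qed blast
  then show ?thesis by blast
qed

definition dker :: "'m \<Rightarrow> complex ^ 'm \<Rightarrow> complex ^ 'm \<Rightarrow> complex" where
  "dker i z = (SOME b. b \<in> elems H \<and> (\<forall>f\<in>elems H. form H f b = partial_deriv i f z))"

lemma elems_dker: "z \<in> \<Omega> \<Longrightarrow> dker i z \<in> elems H"
  and form_dker: "z \<in> \<Omega> \<Longrightarrow> f \<in> elems H \<Longrightarrow> form H f (dker i z) = partial_deriv i f z"
proof -
  assume "z \<in> \<Omega>"
  from partial_deriv_representable[OF this, of i]
  have "\<exists>b. b \<in> elems H \<and> (\<forall>f\<in>elems H. form H f b = partial_deriv i f z)"
    unfolding Bex_def .
  from someI_ex[OF this]
  have *: "dker i z \<in> elems H \<and> (\<forall>f\<in>elems H. form H f (dker i z) = partial_deriv i f z)"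
    unfolding dker_def .
  show "dker i z \<in> elems H" using * by (rule conjunct1)
  show "f \<in> elems H \<Longrightarrow> form H f (dker i z) = partial_deriv i f z"
    by (rule bspec[OF conjunct2[OF *]])
qed

text \<open>
  Both derivatives of \<open>K\<close> become inner products: the antiholomorphic derivative of \<open>K\<close> in the second
  variable is, as a function of the first variable, the element \<open>dker j y\<close>, whose holomorphic derivative is again an
  inner product.
\<close>

lemma gaussian_curvature_eq:
  assumes x: "x \<in> \<Omega>" and y: "y \<in> \<Omega>"
  shows "gaussian_curvature K x y $ i $ j =
    form H (ker y) (ker x) * form H (dker j y) (dker i x) -
    form H (ker y) (dker i x) * form H (dker j y) (ker x)"
proof -
  have bar: "partial_deriv_bar j (K z) y = dker j y z" if z: "z \<in> \<Omega>" for z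
  proof -
    have "partial_deriv j (\<lambda>w. cnj (K z w)) y = partial_deriv j (ker z) y"
      by (rule partial_deriv_cong[OF open_dom y]) (metis cnj_ker ker_apply z)
    also have "\<dots> = form H (ker z) (dker j y)"
      using y z by (simp add: form_dker elems_ker)
    finally have "partial_deriv_bar j (K z) y = form H (dker j y) (ker z)"
      unfolding partial_deriv_bar_def using y z by (simp add: form_cnj elems_ker elems_dker)
    then show ?thesis using y z by (simp add: form_ker elems_dker)
  qed
  have "partial_deriv i (\<lambda>z. partial_deriv_bar j (K z) y) x = form H (dker j y) (dker i x)"
    using partial_deriv_cong[OF open_dom x bar] x y by (simp add: form_dker elems_dker)
  moreover have "partial_deriv i (\<lambda>z. K z y) x = form H (ker y) (dker i x)"
    using partial_deriv_cong[OF open_dom x ker_apply[symmetric, of _ y]] x y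
    by (simp add: form_dker elems_ker)
  ultimately show ?thesis
    using x y bar[OF x] by (simp add: gaussian_curvature_def form_ker elems_ker elems_dker ker_apply)
qed

end

section \<open>The gradient as an operator into the curvature space\<close>

locale gaussian_curvature_rkhs = sesqui_analytic_rkhs \<Omega> K H
  for \<Omega> :: "(complex ^ 'm) set" and K and H +
  fixes HG :: "(complex ^ 'm, complex ^ 'm) function_space"
  assumes vector_rkhs: "is_vector_rkhs \<Omega> (gaussian_curvature K) HG"
begin

sublocale G: hilbert_functions "(*s)" \<Omega> HG
  using module_vector_scalar_mult vector_rkhs
  by (simp add: hilbert_functions_def hilbert_functions_axioms_def is_vector_rkhs_def)

text \<open>
  Kernel functions in the coordinate directions reproduce the single entries of a vector valued
  function, so a moment problem indexed by pairs of a point and a coordinate prescribes the whole function.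
\<close>

definition gker :: "(complex ^ 'm) \<times> 'm \<Rightarrow> complex ^ 'm \<Rightarrow> complex ^ 'm" where
  "gker p = zero_ext \<Omega> (\<lambda>z. gaussian_curvature K z (fst p) *v axis (snd p) 1)"

lemma elems_gker: "fst p \<in> \<Omega> \<Longrightarrow> gker p \<in> elems HG"
  and form_gker: "fst p \<in> \<Omega> \<Longrightarrow> f \<in> elems HG \<Longrightarrow> form HG f (gker p) = f (fst p) $ snd p"
proof -
  assume p: "fst p \<in> \<Omega>"
  have "cvec_inner v (axis j 1) = v $ j" for v :: "complex ^ 'm" and j
    by (simp add: cvec_inner_def axis_def if_distrib cong: if_cong)
  with p show "gker p \<in> elems HG" "f \<in> elems HG \<Longrightarrow> form HG f (gker p) = f (fst p) $ snd p"
    using vector_rkhs unfolding is_vector_rkhs_def gker_def by simp_all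
qed

lemma form_gker_gker:
  assumes "fst p \<in> \<Omega>" "fst q \<in> \<Omega>"
  shows "form HG (gker p) (gker q) =
    form H (ker (fst p)) (ker (fst q)) * form H (dker (snd p) (fst p)) (dker (snd q) (fst q)) -
    form H (ker (fst p)) (dker (snd q) (fst q)) * form H (dker (snd p) (fst p)) (ker (fst q))"
proof -
  have "form HG (gker p) (gker q) = gaussian_curvature K (fst q) (fst p) $ snd q $ snd p"
    unfolding form_gker[OF assms(2) elems_gker[OF assms(1)]] using assms
    by (simp add: gker_def zero_ext_def matrix_vector_mult_def axis_def if_distrib cong: if_cong)
  then show ?thesis using gaussian_curvature_eq[OF assms(2,1)] by simp
qed

text \<open>
  The gradient is obtained as the solution of a moment problem against the functions \<open>gker p\<close>.  Its
  boundedness condition compares \<open>\<Sigma> c\<^sub>p d\<^sub>p\<close>, paired with \<open>f\<close>, with the wedge norm.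
\<close>

theorem gradient_op_bound:
  assumes one: "zero_ext \<Omega> (\<lambda>z. 1) \<in> elems H" and "\<Omega> \<noteq> {}" and f: "f \<in> elems H"
  shows "gradient_op \<Omega> f \<in> elems HG \<and>
    fnorm HG (gradient_op \<Omega> f) \<le> fnorm H (zero_ext \<Omega> (\<lambda>z. 1)) * fnorm H f"
proof -
  define e where "e = zero_ext \<Omega> (\<lambda>z. 1 :: complex)"
  have e: "e \<in> elems H" using one by (simp add: e_def)
  have e1: "e x = 1" if "x \<in> \<Omega>" for x using that by (simp add: e_def zero_ext_def)
  have e0: "e \<noteq> (\<lambda>z. 0)" using e1 \<open>\<Omega> \<noteq> {}\<close> by (metis equals0I zero_neq_one)
  have de: "form H e (dker i x) = 0" if "x \<in> \<Omega>" for i x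
  proof -
    have "partial_deriv i e x = partial_deriv i (\<lambda>_. 1) x"
      by (rule partial_deriv_cong[OF open_dom that e1])
    then show ?thesis using that by (simp add: form_dker e partial_deriv_def)
  qed
  define C where "C = fnorm H e * fnorm H f"
  define J where "J = \<Omega> \<times> (UNIV :: 'm set)"
  have J: "fst p \<in> \<Omega>" if "p \<in> J" for p using that by (auto simp: J_def)
  obtain g where g: "g \<in> elems HG" "fnorm HG g \<le> C"
      "\<And>p. p \<in> J \<Longrightarrow> form HG (gker p) g = cnj (partial_deriv (snd p) f (fst p))"
  proof (rule G.interpolation[of J gker "\<lambda>p. cnj (partial_deriv (snd p) f (fst p))" C])
    show "gker p \<in> elems HG" if "p \<in> J" for p
      using J[OF that] by (rule elems_gker)
    show "0 \<le> C" unfolding C_def by (intro mult_nonneg_nonneg fnorm_nonneg e f)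
    fix X :: "((complex ^ 'm) \<times> 'm) set" and c assume X: "finite X" "X \<subseteq> J"
    define a where "a p = ker (fst p)" for p :: "(complex ^ 'm) \<times> 'm"
    define b where "b p = (\<lambda>z. c p * dker (snd p) (fst p) z)" for p
    define F where "F = (\<lambda>z. \<Sum>p\<in>X. c p *s gker p z)"
    have XO: "fst p \<in> \<Omega>" if "p \<in> X" for p using that X(2) J by blast
    have ab: "a p \<in> elems H" "b p \<in> elems H" "dker (snd p) (fst p) \<in> elems H" if "p \<in> X" for p
      using XO[OF that] by (simp_all add: a_def b_def elems_ker elems_dker elems_scl)
    have gX: "gker p \<in> elems HG" "(\<lambda>z. c p *s gker p z) \<in> elems HG" if "p \<in> X" for p
      using XO[OF that] by (simp_all add: elems_gker G.elems_scl)
    have F: "F \<in> elems HG"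
      unfolding F_def by (rule G.elems_sum[OF gX(2)])
    have B: "(\<lambda>z. \<Sum>p\<in>X. b p z) \<in> elems H"
      by (rule elems_sum[OF ab(2)])
    have "form HG F F = (\<Sum>p\<in>X. form HG (\<lambda>z. c p *s gker p z) F)"
      using G.form_sum[OF gX(2) F] unfolding F_def .
    also have "\<dots> = (\<Sum>p\<in>X. \<Sum>q\<in>X. form HG (\<lambda>z. c p *s gker p z) (\<lambda>z. c q *s gker q z))"
      unfolding F_def by (rule sum.cong[OF refl], rule G.form_sum_right[OF gX(2) gX(2)])
    also have "\<dots> = wedge_gram X a b"
      unfolding wedge_gram_def
    proof (intro sum.cong refl)
      fix p q assume pq: "p \<in> X" "q \<in> X"
      show "form HG (\<lambda>z. c p *s gker p z) (\<lambda>z. c q *s gker q z) =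
          form H (a p) (a q) * form H (b p) (b q) - form H (a p) (b q) * form H (b p) (a q)"
      proof -
        have e1: "form HG (\<lambda>z. c p *s gker p z) (\<lambda>z. c q *s gker q z) =
            c p * (cnj (c q) * form HG (gker p) (gker q))"
          unfolding G.form_scl[OF gX(1)[OF pq(1)] gX(2)[OF pq(2)]]
            G.form_scl_right[OF gX(1)[OF pq(2)] gX(1)[OF pq(1)]] ..
        have e2: "form H (b p) (b q) =
            c p * (cnj (c q) * form H (dker (snd p) (fst p)) (dker (snd q) (fst q)))"
          unfolding b_def form_scl[OF ab(3)[OF pq(1)] elems_scl[OF ab(3)[OF pq(2)]]]
            form_scl_right[OF ab(3)[OF pq(2)] ab(3)[OF pq(1)]] ..
        have e3: "form H (a p) (b q) = cnj (c q) * form H (a p) (dker (snd q) (fst q))"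
          unfolding b_def by (rule form_scl_right[OF ab(3)[OF pq(2)] ab(1)[OF pq(1)]])
        have e4: "form H (b p) (a q) = c p * form H (dker (snd p) (fst p)) (a q)"
          unfolding b_def by (rule form_scl[OF ab(3)[OF pq(1)] ab(1)[OF pq(2)]])
        show ?thesis
          unfolding e1 e2 e3 e4 form_gker_gker[OF XO[OF pq(1)] XO[OF pq(2)]]
          by (simp only: a_def right_diff_distrib mult_ac)
      qed
    qed
    finally have FF: "(fnorm HG F)\<^sup>2 = Re (wedge_gram X a b)"
      using G.fnorm_power2[OF F] by simp
    have "(fnorm H (\<lambda>z. \<Sum>p\<in>X. b p z))\<^sup>2 \<le> (fnorm H e)\<^sup>2 * Re (wedge_gram X a b)"
    proof (rule norm_sum_le_wedge_gram[OF X(1) e e0 ab(1,2)])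
      show "form H (a p) e = 1" if "p \<in> X" for p
        using form_cnj[OF e ab(1)[OF that]] XO[OF that] by (simp add: a_def form_ker e e1)
      show "form H (b p) e = 0" if "p \<in> X" for p
        using form_cnj[OF e ab(3)[OF that]] XO[OF that] ab[OF that]
        by (simp add: b_def form_scl e de)
    qed
    then have "fnorm H (\<lambda>z. \<Sum>p\<in>X. b p z) \<le> fnorm H e * fnorm HG F"
      unfolding FF[symmetric] power_mult_distrib[symmetric]
      by (rule power2_le_imp_le) (intro mult_nonneg_nonneg fnorm_nonneg G.fnorm_nonneg e F)
    then have "fnorm H (\<lambda>z. \<Sum>p\<in>X. b p z) * fnorm H f \<le> C * fnorm HG F"
      using mult_right_mono[OF _ fnorm_nonneg[OF f]] unfolding C_def by (fastforce simp: mult_ac)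
    moreover have "form H (\<lambda>z. \<Sum>p\<in>X. b p z) f = (\<Sum>p\<in>X. c p * cnj (partial_deriv (snd p) f (fst p)))"
    proof -
      have "form H (\<lambda>z. \<Sum>p\<in>X. b p z) f = (\<Sum>p\<in>X. form H (b p) f)"
        by (rule form_sum[OF ab(2) f])
      also have "\<dots> = (\<Sum>p\<in>X. c p * cnj (partial_deriv (snd p) f (fst p)))"
      proof (rule sum.cong[OF refl])
        fix p assume p: "p \<in> X"
        show "form H (b p) f = c p * cnj (partial_deriv (snd p) f (fst p))"
          using form_cnj[OF f ab(3)[OF p]] XO[OF p] ab[OF p]
          by (simp add: b_def form_scl f form_dker)
      qed
      finally show ?thesis .
    qed
    ultimately show "norm (\<Sum>p\<in>X. c p * cnj (partial_deriv (snd p) f (fst p)))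
        \<le> C * fnorm HG (\<lambda>z. \<Sum>p\<in>X. c p *s gker p z)"
      using Cauchy_Schwarz_form[OF B f] unfolding F_def by simp
  qed blast
  have "g = gradient_op \<Omega> f"
  proof
    fix x
    show "g x = gradient_op \<Omega> f x"
    proof (cases "x \<in> \<Omega>")
      case True
      have "g x $ i = partial_deriv i f x" for i
      proof -
        have "g x $ i = cnj (form HG (gker (x, i)) g)"
          using True g(1) by (simp add: G.form_cnj elems_gker form_gker)
        also have "\<dots> = partial_deriv i f x"
          using g(3)[of "(x, i)"] True by (simp add: J_def)
        finally show ?thesis .
      qed
      then show ?thesis using True by (simp add: gradient_op_def zero_ext_def vec_eq_iff)
    next
      case False
      then show ?thesis
        by (simp add: G.elems_outside[OF g(1)] gradient_op_def zero_ext_def)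
    qed
  qed
  with g show ?thesis by (simp add: C_def e_def)
qed

theorem gradient_op_bounded_linear:
  assumes one: "zero_ext \<Omega> (\<lambda>z. 1) \<in> elems H" and "\<Omega> \<noteq> {}"
  shows "bounded_linear_op (*) (*s) H HG (gradient_op \<Omega>)"
    and "op_norm H HG (gradient_op \<Omega>) \<le> fnorm H (zero_ext \<Omega> (\<lambda>z. 1))"
proof -
  note bd = gradient_op_bound[OF assms]
  show "bounded_linear_op (*) (*s) H HG (gradient_op \<Omega>)"
    unfolding bounded_linear_op_def
  proof (intro conjI ballI allI)
    show "gradient_op \<Omega> (\<lambda>z. f z + g z) = (\<lambda>z. gradient_op \<Omega> f z + gradient_op \<Omega> g z)"
      if "f \<in> elems H" "g \<in> elems H" for f g
      using that by (auto simp: gradient_op_def zero_ext_def partial_deriv_add vec_eq_iff)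
    show "gradient_op \<Omega> (\<lambda>z. c * f z) = (\<lambda>z. c *s gradient_op \<Omega> f z)" if "f \<in> elems H" for c f
      using that by (auto simp: gradient_op_def zero_ext_def partial_deriv_mult_const vec_eq_iff)
  qed (use bd in blast)+
  show "op_norm H HG (gradient_op \<Omega>) \<le> fnorm H (zero_ext \<Omega> (\<lambda>z. 1))"
    unfolding op_norm_def
  proof (rule cSUP_least)
    have "(\<lambda>z. 0) \<in> {f \<in> elems H. fnorm H f \<le> 1}"
      by (simp add: elems_zero fnorm_zero)
    then show "{f \<in> elems H. fnorm H f \<le> 1} \<noteq> {}" by blast
    fix f assume f: "f \<in> {f \<in> elems H. fnorm H f \<le> 1}"
    have "fnorm HG (gradient_op \<Omega> f) \<le> fnorm H (zero_ext \<Omega> (\<lambda>z. 1)) * fnorm H f"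
      using bd f by blast
    also have "\<dots> \<le> fnorm H (zero_ext \<Omega> (\<lambda>z. 1)) * 1"
      using f by (intro mult_left_mono fnorm_nonneg one) auto
    finally show "fnorm HG (gradient_op \<Omega> f) \<le> fnorm H (zero_ext \<Omega> (\<lambda>z. 1))" by simp
  qed
qed

text \<open>
  A normalised kernel has the constant function as its kernel function at \<open>w0\<close>, so its squared norm is
  its value at \<open>w0\<close>.
\<close>

lemma one_of_normalized:
  assumes w0: "w0 \<in> \<Omega>" and norm: "\<And>z. z \<in> \<Omega> \<Longrightarrow> K z w0 = 1"
  shows "zero_ext \<Omega> (\<lambda>z. 1) \<in> elems H" "fnorm H (zero_ext \<Omega> (\<lambda>z. 1)) = 1"
proof -
  have eq: "zero_ext \<Omega> (\<lambda>z. 1) = ker w0"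
    using norm by (simp add: ker_def zero_ext_def fun_eq_iff)
  show "zero_ext \<Omega> (\<lambda>z. 1) \<in> elems H"
    unfolding eq by (rule elems_ker[OF w0])
  show "fnorm H (zero_ext \<Omega> (\<lambda>z. 1)) = 1"
    unfolding eq fnorm_def using w0 norm by (simp add: form_ker elems_ker ker_apply)
qed

end

theorem corollary2p8:
  fixes \<Omega> :: "(complex ^ 'm) set"
    and K :: "complex ^ 'm \<Rightarrow> complex ^ 'm \<Rightarrow> complex"
    and HK :: "(complex ^ 'm, complex) function_space"
    and HG :: "(complex ^ 'm, complex ^ 'm) function_space"
  assumes "open \<Omega>" and "connected \<Omega>" and "\<Omega> \<noteq> {}"
    and "sesqui_analytic \<Omega> K"
    and "nonneg_definite_kernel \<Omega> K"
    and "is_rkhs \<Omega> K HK"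
    and "is_vector_rkhs \<Omega> (gaussian_curvature K) HG"
  shows "(zero_ext \<Omega> (\<lambda>z. 1) \<in> elems HK \<longrightarrow>
            bounded_linear_op (*) (*s) HK HG (gradient_op \<Omega>) \<and>
            op_norm HK HG (gradient_op \<Omega>) \<le> fnorm HK (zero_ext \<Omega> (\<lambda>z. 1))) \<and>
         (\<forall>w0\<in>\<Omega>. (\<forall>z\<in>\<Omega>. K z w0 = 1) \<longrightarrow>
            bounded_linear_op (*) (*s) HK HG (gradient_op \<Omega>) \<and>
            op_norm HK HG (gradient_op \<Omega>) \<le> 1)"
proof -
  interpret gaussian_curvature_rkhs \<Omega> K HK HG
    using assms by unfold_locales
  show ?thesis
  proof (intro conjI impI ballI)
    fix w0 assume w0: "w0 \<in> \<Omega>" "\<forall>z\<in>\<Omega>. K z w0 = 1"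
    then have one: "zero_ext \<Omega> (\<lambda>z. 1) \<in> elems HK" "fnorm HK (zero_ext \<Omega> (\<lambda>z. 1)) = 1"
      using one_of_normalized[of w0] by blast+
    show "bounded_linear_op (*) (*s) HK HG (gradient_op \<Omega>)"
      "op_norm HK HG (gradient_op \<Omega>) \<le> 1"
      using gradient_op_bounded_linear[OF one(1) assms(3)] one(2) by simp_all
  qed (use gradient_op_bounded_linear[OF _ assms(3)] in blast)+
qed

end
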